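(* Let $0\leq m\leq n$ be integers. (i) Given a polynomial $p\in\mathcal{P}^m$, the Inequality Algorithm exactly computes the Bernstein coefficients (in the degree $m$ Bernstein basis) of the unique polynomial $q\in\mathcal{P}^{m,n}$ that minimizes $\|p-q\|_{L^2}$, in at most $$M(n+1)(2n+2m+3)+(n+1)(2m+1)+2(m+1)^2+\frac{2^{n-1}}{3}(n+1)^2(n+4)$$ operations. (ii) Given a polynomial $p\in\mathcal{P}^m$ that is the best $L^2$ approximation in $\mathcal{P}^m$ of some continuous nonnegative function on $[0,1]$, the Equality Algorithm exactly computes the Bernstein coefficients (in the degree $m$ Bernstein basis) of the unique polynomial $q\in\mathcal{P}^{m,n}$ that minimizes $\|p-q\|_{L^2}$ subject to $\int_0^1 p(x)\,dx=\int_0^1 q(x)\,dx$, in at most $$N[2(n+1)(n+m+2)+n]+(n+1)(2m+1)+2(m+1)^2+\frac{2^{n-1}}{3}(n+1)^2(n+4)$$ operations. Here $M$ and $N$ denote the number of times, in the run of the Inequality Algorithm and of the Equality Algorithm respectively, that the linear system for the current subset $J$ has a nonnegative solution.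
   Context: Polynomials and norms. $\mathcal{P}^m$ is the space of real univariate polynomials of degree at most $m$; $\|g\|_{L^2}=\left(\int_0^1 g(x)^2dx\right)^{1/2}$. Bernstein polynomials: $B^n_i(x)=\binom{n}{i}x^i(1-x)^{n-i}$, $0\leq i\leq n$, a basis of $\mathcal{P}^n$. For a polynomial $p$ regarded as an element of $\mathcal{P}^m$, $\mathbf{\Pi}(p)\in\mathbb{R}^{m+1}$ is its coefficient vector in $\{B^m_i\}_{i=0}^m$. For $m\leq n$, $E^{m,n}$ is the $(n+1)\times(m+1)$ matrix mapping degree $m$ Bernstein coefficients to degree $n$ Bernstein coefficients of the same polynomial, $E^{m,n}_{ij}=\binom{m}{j}\binom{n-m}{i-j}/\binom{n}{i}$ (out-of-range binomials are $0$). $\mathcal{P}^{m,n}=\{p\in\mathcal{P}^m: E^{m,n}\mathbf{\Pi}(p)\geq 0 \text{ componentwise}\}$. Matrices. $L^j$ is the Legendre polynomial of degree $j$ mapped to $[0,1]$ and scaled so that $L^j(1)=1$; then $\|L^j\|_{L^2}^2=\frac{1}{2j+1}$ and its degree $j$ Bernstein coefficients are $\mathbf{\Pi}(L^j)_i=(-1)^{j+i}\binom{j}{i}$. $U^{m,n}$ is the $(n+1)\times(m+1)$ matrix whose $j$-th column is $\sqrt{2j+1}\,E^{j,n}\mathbf{\Pi}(L^j)$, $0\leq j\leq m$. $W^{m,n}=\frac12U^{m,n}(U^{m,n})^T$. $\lambda^n_j=\frac{(n!)^2}{(n+j+1)!(n-j)!}$. $\mathbf{1}^n$ is the vector of ones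 of length $n+1$. Inequality Algorithm (input $p\in\mathcal{P}^m$). Loop over all subsets $J\subseteq\{0,\dots,n\}$ (including $\emptyset$ and the full set). For each $J$, form the $|J|\times|J|$ matrix $A=(W^{m,n}_{ij})_{i,j\in J}$ and the vector $b=(-(E^{m,n}\mathbf{\Pi}(p))_i)_{i\in J}$. If $A$ has rank $|J|$, set $x=A^{-1}b$. If $x\geq0$ componentwise, let $\mu\in\mathbb{R}^{n+1}$ be given by $\mu_i=x_i$ for $i\in J$ and $\mu_i=0$ for $i\notin J$, and form $y=W^{m,n}\mu+E^{m,n}\mathbf{\Pi}(p)$. If $y\geq0$ componentwise, return $\mathbf{q}=U^{m,m}\operatorname{diag}(\lambda^n_0,\dots,\lambda^n_m)(U^{m,n})^Ty$ and stop. Otherwise go on to the next $J$. Equality Algorithm (input $p\in\mathcal{P}^m$). Identical, except that $A=(W^{m,n}_{ij}-\frac12)_{i,j\in J}$, and once $\mu$ is formed one sets $\nu=\sum_{i=0}^n\mu_i$ and $y=W^{m,n}\mu-\frac{\nu}{2}\mathbf{1}^n+E^{m,n}\mathbf{\Pi}(p)$. The "linear system for $J$" is $Ax=b$ with $A,b$ as in the corresponding algorithm; $M$ (resp. $N$) is thus the number of times the vector $y$ is formed in the Inequality (resp. Equality) Algorithm. Operation count. Operations are floating-point arithmetic operations, in exact arithmetic, with the matrices $E^{m,n},U^{m,m},U^{m,n},W^{m,n}$ and numbers $\lambda^n_j$ regarded as available, and with the following costs counted: solving $Ax=b$ for a given $J$ costs $2|J|^3/3$ operations; forming $y$ in the Inequality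 Algorithm costs $(n+1)(2n+2m+3)$ operations; forming $\nu$ and $y$ in the Equality Algorithm costs $2(n+1)(n+m+2)+n$ operations; forming $\mathbf{q}$ (done once, at termination) costs $(n+1)(2m+1)+2(m+1)^2$ operations. *)

theory Defs
  imports
    "HOL-Analysis.Analysis"
    "HOL-Computational_Algebra.Polynomial"
    "Jordan_Normal_Form.DL_Rank"
    "Jordan_Normal_Form.DL_Submatrix"
    "Jordan_Normal_Form.Gauss_Jordan_Elimination"
begin

unbundle no vec_syntax

text \<open>
  Vectors and matrices are those of \<^theory>\<open>Jordan_Normal_Form.Matrix\<close>, indexed from 0, so that the
  dimensions may depend on the natural numbers m and n. The relation \<open>\<le>\<close> on vectors is componentwise
  and includes equality of dimensions.
\<close>

definition L2_norm :: "(real \<Rightarrow> real) \<Rightarrow> real" where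
  "L2_norm g = sqrt (integral {0..1} (\<lambda>x. (g x)\<^sup>2))"

definition poly_space :: "nat \<Rightarrow> real poly set" where
  "poly_space m = {p. degree p \<le> m}"

definition bernstein_coeffs :: "nat \<Rightarrow> real poly \<Rightarrow> real Matrix.vec" where
  "bernstein_coeffs m p =
     (THE c. c \<in> carrier_vec (m + 1) \<and> (\<forall>x. poly p x = (\<Sum>i\<le>m. c $ i * Bernstein m i x)))"

text \<open>Natural subtraction truncates, hence the explicit case \<open>i < j\<close>.\<close>

definition E_mat :: "nat \<Rightarrow> nat \<Rightarrow> real Matrix.mat" where
  "E_mat m n = Matrix.mat (n + 1) (m + 1)
     (\<lambda>(i, j). if j \<le> i then real (m choose j) * real ((n - m) choose (i - j)) / real (n choose i)
               else 0)"

definition nonneg_poly_space :: "nat \<Rightarrow> nat \<Rightarrow> real poly set" where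
  "nonneg_poly_space m n =
     {p \<in> poly_space m. 0\<^sub>v (n + 1) \<le> E_mat m n *\<^sub>v bernstein_coeffs m p}"

text \<open>
  The Legendre polynomial on \<open>[-1,1]\<close> by Rodrigues' formula, which already takes the value 1 at 1,
  and its transport to \<open>[0,1]\<close> by the substitution \<open>x \<mapsto> 2 x - 1\<close>.
\<close>

definition legendre_poly :: "nat \<Rightarrow> real poly" where
  "legendre_poly j = Polynomial.smult (1 / (2 ^ j * fact j)) ((pderiv ^^ j) ([:-1, 0, 1:] ^ j))"

definition legendre01 :: "nat \<Rightarrow> real poly" where
  "legendre01 j = pcompose (legendre_poly j) [:-1, 2:]"

definition U_mat :: "nat \<Rightarrow> nat \<Rightarrow> real Matrix.mat" where
  "U_mat m n = mat_of_cols (n + 1)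
     (map (\<lambda>j. sqrt (2 * real j + 1) \<cdot>\<^sub>v (E_mat j n *\<^sub>v bernstein_coeffs j (legendre01 j))) [0..<m + 1])"

definition W_mat :: "nat \<Rightarrow> nat \<Rightarrow> real Matrix.mat" where
  "W_mat m n = (1 / 2) \<cdot>\<^sub>m (U_mat m n * transpose_mat (U_mat m n))"

definition lam :: "nat \<Rightarrow> nat \<Rightarrow> real" where
  "lam n j = (fact n)\<^sup>2 / (fact (n + j + 1) * fact (n - j))"

definition ones :: "nat \<Rightarrow> real Matrix.vec" where
  "ones n = Matrix.vec (n + 1) (\<lambda>_. 1)"

text \<open>
  A vector indexed by \<open>J \<subseteq> {0..n}\<close> is stored as a vector of length \<open>card J\<close> by listing \<open>J\<close>
  increasingly, as \<^const>\<open>submatrix\<close> does: \<open>pick J k\<close> is the k-th element of \<open>J\<close>, and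
  \<open>card {j \<in> J. j < i}\<close> is the position of \<open>i \<in> J\<close>.
\<close>

definition subvector :: "real Matrix.vec \<Rightarrow> nat set \<Rightarrow> real Matrix.vec" where
  "subvector v J = Matrix.vec (card J) (\<lambda>k. v $ pick J k)"

definition extend_by_zero :: "nat \<Rightarrow> nat set \<Rightarrow> real Matrix.vec \<Rightarrow> real Matrix.vec" where
  "extend_by_zero n J x = Matrix.vec (n + 1) (\<lambda>i. if i \<in> J then x $ card {j \<in> J. j < i} else 0)"

definition solve_cost :: "nat set \<Rightarrow> real" where
  "solve_cost J = 2 * real (card J) ^ 3 / 3"

definition q_cost :: "nat \<Rightarrow> nat \<Rightarrow> real" where
  "q_cost m n = (real n + 1) * (2 * real m + 1) + 2 * (real m + 1)\<^sup>2"

definition y_cost_ineq :: "nat \<Rightarrow> nat \<Rightarrow> real" where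
  "y_cost_ineq m n = (real n + 1) * (2 * real n + 2 * real m + 3)"

definition y_cost_eq :: "nat \<Rightarrow> nat \<Rightarrow> real" where
  "y_cost_eq m n = 2 * (real n + 1) * (real n + real m + 2) + real n"

text \<open>
  Record of a run: the returned vector (\<^const>\<open>None\<close> if the loop ends without returning), the number
  of times the linear system had a nonnegative solution, i.e. y was formed, and the operation count.
\<close>

datatype run = Run (returned: "real Matrix.vec option") (nonneg_solutions: nat) (operations: real)

text \<open>
  The loop shared by the two algorithms, over the subsets in the given order. \<open>A J\<close> is the matrix of
  the linear system for \<open>J\<close>, \<open>form_y\<close> maps \<open>\<mu>\<close> to y, and \<open>y_cost\<close> is the cost of that step. The cost
  of the linear solve is charged for every subset visited, including those with singular \<open>A J\<close>.
\<close>

primrec subset_loop ::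
  "nat \<Rightarrow> nat \<Rightarrow> real poly \<Rightarrow> (nat set \<Rightarrow> real Matrix.mat) \<Rightarrow> (real Matrix.vec \<Rightarrow> real Matrix.vec) \<Rightarrow>
   real \<Rightarrow> nat set list \<Rightarrow> run" where
  "subset_loop m n p A form_y y_cost [] = Run None 0 0"
| "subset_loop m n p A form_y y_cost (J # Js) =
    (let b = subvector (- (E_mat m n *\<^sub>v bernstein_coeffs m p)) J;
         x = the (mat_inverse (A J)) *\<^sub>v b;
         y = form_y (extend_by_zero n J x);
         q = U_mat m m *\<^sub>v (mat_diag (m + 1) (lam n) *\<^sub>v (transpose_mat (U_mat m n) *\<^sub>v y));
         rest = subset_loop m n p A form_y y_cost Js
     in if vec_space.rank (card J) (A J) = card J \<and> 0\<^sub>v (card J) \<le> x then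
          if 0\<^sub>v (n + 1) \<le> y then Run (Some q) 1 (solve_cost J + y_cost + q_cost m n)
          else Run (returned rest) (nonneg_solutions rest + 1) (operations rest + solve_cost J + y_cost)
        else Run (returned rest) (nonneg_solutions rest) (operations rest + solve_cost J))"

definition inequality_algorithm :: "nat \<Rightarrow> nat \<Rightarrow> nat set list \<Rightarrow> real poly \<Rightarrow> run" where
  "inequality_algorithm m n Js p =
     subset_loop m n p
       (\<lambda>J. submatrix (W_mat m n) J J)
       (\<lambda>\<mu>. W_mat m n *\<^sub>v \<mu> + E_mat m n *\<^sub>v bernstein_coeffs m p)
       (y_cost_ineq m n) Js"

definition equality_algorithm :: "nat \<Rightarrow> nat \<Rightarrow> nat set list \<Rightarrow> real poly \<Rightarrow> run" where
  "equality_algorithm m n Js p =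
     subset_loop m n p
       (\<lambda>J. submatrix (Matrix.mat (n + 1) (n + 1) (\<lambda>(i, j). W_mat m n $$ (i, j) - 1 / 2)) J J)
       (\<lambda>\<mu>. let \<nu> = (\<Sum>i\<le>n. \<mu> $ i)
             in W_mat m n *\<^sub>v \<mu> - (\<nu> / 2) \<cdot>\<^sub>v ones n + E_mat m n *\<^sub>v bernstein_coeffs m p)
       (y_cost_eq m n) Js"

definition ineq_minimizer :: "nat \<Rightarrow> nat \<Rightarrow> real poly \<Rightarrow> real poly \<Rightarrow> bool" where
  "ineq_minimizer m n p q \<longleftrightarrow>
     is_arg_min (\<lambda>q. L2_norm (poly (p - q))) (\<lambda>q. q \<in> nonneg_poly_space m n) q"

definition eq_minimizer :: "nat \<Rightarrow> nat \<Rightarrow> real poly \<Rightarrow> real poly \<Rightarrow> bool" where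
  "eq_minimizer m n p q \<longleftrightarrow>
     is_arg_min (\<lambda>q. L2_norm (poly (p - q)))
       (\<lambda>q. q \<in> nonneg_poly_space m n \<and> integral {0..1} (poly p) = integral {0..1} (poly q)) q"

definition best_L2_approx :: "nat \<Rightarrow> (real \<Rightarrow> real) \<Rightarrow> real poly \<Rightarrow> bool" where
  "best_L2_approx m f p \<longleftrightarrow>
     is_arg_min (\<lambda>g. L2_norm (\<lambda>x. f x - poly g x)) (\<lambda>g. g \<in> poly_space m) p"

end

theory Submission
  imports Defs
begin

text \<open>
  The polynomials \<open>onb j = sqrt (2 j + 1) * L\<^sup>j\<close> are an orthonormal basis of the polynomials for the
  inner product of \<open>L\<^sup>2(0,1)\<close>, and the columns of \<^const>\<open>U_mat\<close> are their degree n Bernstein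
  coefficients. In the coordinates \<open>c\<close> of this basis both problems ask for the point nearest to the
  coordinates of p in the polyhedron \<open>U c \<ge> 0\<close>; in the equality problem the coordinate of
  \<open>onb 0 = 1\<close>, which is the integral, is kept fixed. Write S for the set of free coordinates,
  \<open>{0..m}\<close> or \<open>{1..m}\<close>, and \<open>u i j\<close> for the i-th degree n coefficient of \<open>onb j\<close>. The
  Karush-Kuhn-Tucker conditions are the complementarity problem
  \<open>\<mu> \<ge> 0, y = G \<mu> + g \<ge> 0, \<mu> \<bullet> y = 0\<close>, where g holds the degree n coefficients of p and
  \<open>G i k = 1/2 * (\<Sum>j\<in>S. u i j * u k j)\<close>. This G is \<open>W\<close> in the inequality problem and, since the
  degree n coefficients of 1 are all 1, it is \<open>W - 1/2\<close> in the equality problem.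

  Soundness: whenever the loop returns, the vector \<open>\<mu>\<close> built from J solves this problem, because
  y vanishes on J and \<open>\<mu>\<close> vanishes off J. A solution yields a polynomial that beats every other
  feasible q by at least the squared norm of the difference (\<open>KKT_strict_minimizer\<close>), hence the
  minimizer exists and is unique and all successful subsets give the same answer.

  Termination with success (\<open>complementary_solution_exists\<close>): some solution is supported on a set J
  whose principal submatrix is nonsingular. Consider the convex quadratic
  \<open>\<mu> \<bullet> G \<mu> / 2 + g \<bullet> \<mu>\<close> on \<open>\<mu> \<ge> 0\<close>. Any \<open>\<mu> \<ge> 0\<close> can be moved, without increasing the value and
  without enlarging the support, to a stationary point for a nonsingular support
  (\<open>reduce_to_candidate\<close>): move towards the stationary point of the current support, or along a
  null direction if the support is singular, until a coordinate vanishes, and recurse. There are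
  finitely many such points, and the best of them satisfies \<open>y \<ge> 0\<close>, as otherwise raising one
  coordinate would lower the value. No compactness is needed, but the quadratic must not decrease
  along nonnegative null directions. In the inequality problem g is orthogonal to the kernel of G;
  in the equality problem the only contribution is the integral of p times the sum of the entries
  of the direction, and the integral of p equals that of the function it approximates
  (\<open>best_L2_approx_integral_nonneg\<close>).

  Recovery of q from y: \<open>U\<^sup>T U\<close> is diagonal with entries \<open>1 / lam n j\<close>. The Bernstein-Durrmeyer
  operator, which sends f to the sum of \<open>(\<integral> B\<^sub>i f) B\<^sub>i\<close>, is symmetric and does not raise degrees, so
  the Legendre polynomials are its eigenvectors, and its action on leading coefficients shows that
  the eigenvalues are \<open>lam n j\<close> (\<open>durrmeyer_onb\<close>). Therefore \<open>u i j = (\<integral> B\<^sub>i onb j) / lam n j\<close>, and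
  summing against the degree n coefficients of q gives the j-th coordinate of q divided by
  \<open>lam n j\<close>.

  Cost: every subset is visited at most once, and summing \<open>2/3 * card J ^ 3\<close> over all J gives the
  last term of the bound.
\<close>

section \<open>Complementary solutions of a semidefinite quadratic program\<close>

text \<open>
  The principal submatrix of W on J is nonsingular. It is expressed through vectors indexed by all of
  \<open>nat\<close> that vanish off J, so that supports can vary without reindexing.
\<close>

definition nonsingular_on :: "nat \<Rightarrow> (nat \<Rightarrow> nat \<Rightarrow> real) \<Rightarrow> nat set \<Rightarrow> bool" where
  "nonsingular_on n W J \<longleftrightarrow>
     (\<forall>z. (\<forall>i. i \<notin> J \<longrightarrow> z i = 0) \<longrightarrow> (\<forall>i\<in>J. (\<Sum>k\<le>n. W i k * z k) = 0) \<longrightarrow> (\<forall>i. z i = 0))"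

lemma nonsingular_onD:
  "nonsingular_on n W J \<Longrightarrow> (\<And>i. i \<notin> J \<Longrightarrow> z i = 0) \<Longrightarrow> (\<And>i. i \<in> J \<Longrightarrow> (\<Sum>k\<le>n. W i k * z k) = 0) \<Longrightarrow> z i = 0"
  by (auto simp: nonsingular_on_def)

lemma mult_delta: "(if P then 1 else 0) * c = (if P then c else 0 :: real)"
  by simp

text \<open>
  On the ray from a nonnegative vector a in the direction z, the first parameter s at which a
  coordinate that z decreases becomes zero.
\<close>

lemma exists_first_hit:
  fixes a z :: "nat \<Rightarrow> real"
  assumes K: "finite K" and a: "\<And>i. 0 \<le> a i" and i: "i \<in> K" "z i < 0"
  obtains i0 s where "i0 \<in> K" "z i0 < 0" "0 \<le> s" "a i0 + s * z i0 = 0"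
    "\<And>k. k \<in> K \<Longrightarrow> 0 \<le> a k + s * z k" "s \<le> a i / - z i"
proof -
  define N where "N = {k \<in> K. z k < 0}"
  have N: "finite N" "N \<noteq> {}" using K i by (auto simp: N_def)
  obtain i0 where i0: "i0 \<in> N" and least: "\<And>k. k \<in> N \<Longrightarrow> a i0 / - z i0 \<le> a k / - z k"
    using arg_min_if_finite[OF N, of "\<lambda>k. a k / - z k"] by (metis (no_types) not_le)
  define s where "s = a i0 / - z i0"
  have z0: "i0 \<in> K" "z i0 < 0" using i0 by (auto simp: N_def)
  have s0: "0 \<le> s" using a[of i0] z0 by (simp add: s_def divide_nonneg_neg)
  show thesis
  proof (rule that[OF z0 s0])
    show "a i0 + s * z i0 = 0" using z0 by (simp add: s_def)
    show "s \<le> a i / - z i" using least[of i] i by (simp add: N_def s_def)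
    fix k assume k: "k \<in> K"
    show "0 \<le> a k + s * z k"
    proof (cases "z k < 0")
      case True
      then have "s \<le> a k / - z k" using least[of k] k by (simp add: N_def s_def)
      then have "s * - z k \<le> a k" using True by (simp add: pos_le_divide_eq del: divide_minus_right)
      then show ?thesis by simp
    next
      case False
      then show ?thesis using a[of k] s0 by simp
    qed
  qed
qed

text \<open>
  The quadratic \<open>z \<bullet> W z / 2 + g \<bullet> z\<close> on nonnegative z, for positive semidefinite W and a linear part
  that is nonnegative on the nonnegative vectors in the kernel of W.
\<close>

context
  fixes n :: nat and W :: "nat \<Rightarrow> nat \<Rightarrow> real" and g :: "nat \<Rightarrow> real"
  assumes sym: "\<And>i k. W i k = W k i"
    and psd: "\<And>z. 0 \<le> (\<Sum>i\<le>n. z i * (\<Sum>k\<le>n. W i k * z k))"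
    and bounded_below: "\<And>z. (\<And>i. 0 \<le> z i) \<Longrightarrow> (\<And>i. i \<le> n \<Longrightarrow> (\<Sum>k\<le>n. W i k * z k) = 0)
           \<Longrightarrow> 0 \<le> (\<Sum>i\<le>n. g i * z i)"
    and solvable: "\<And>J h. J \<subseteq> {..n} \<Longrightarrow> nonsingular_on n W J \<Longrightarrow>
           \<exists>\<beta>. (\<forall>i. i \<notin> J \<longrightarrow> \<beta> i = 0) \<and> (\<forall>i\<in>J. (\<Sum>k\<le>n. W i k * \<beta> k) = h i)"
begin

text \<open>
  The product \<open>W z\<close>, the bilinear form of W, and the quadratic to be minimized.
\<close>

definition apply_W :: "(nat \<Rightarrow> real) \<Rightarrow> nat \<Rightarrow> real" where
  "apply_W z i = (\<Sum>k\<le>n. W i k * z k)"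

definition bilinear :: "(nat \<Rightarrow> real) \<Rightarrow> (nat \<Rightarrow> real) \<Rightarrow> real" where
  "bilinear a b = (\<Sum>i\<le>n. a i * apply_W b i)"

definition objective :: "(nat \<Rightarrow> real) \<Rightarrow> real" where
  "objective z = bilinear z z / 2 + (\<Sum>i\<le>n. g i * z i)"

lemma apply_W_diff: "apply_W (\<lambda>i. a i - b i) k = apply_W a k - apply_W b k"
  by (simp add: apply_W_def sum_subtractf algebra_simps)

lemma apply_W_comb: "apply_W (\<lambda>i. a i + t * b i) k = apply_W a k + t * apply_W b k"
  by (simp add: apply_W_def sum.distrib sum_distrib_left algebra_simps)

lemma bilinear_commute: "bilinear a b = bilinear b a"
proof -
  have "bilinear a b = (\<Sum>i\<le>n. \<Sum>k\<le>n. a i * (W i k * b k))"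
    by (simp add: bilinear_def apply_W_def sum_distrib_left)
  also have "\<dots> = (\<Sum>k\<le>n. \<Sum>i\<le>n. a i * (W i k * b k))" by (rule sum.swap)
  also have "\<dots> = bilinear b a"
    unfolding bilinear_def apply_W_def sum_distrib_left
    by (intro sum.cong refl) (use sym in \<open>auto simp: algebra_simps\<close>)
  finally show ?thesis .
qed

lemma bilinear_comb_right: "bilinear a (\<lambda>i. b i + t * c i) = bilinear a b + t * bilinear a c"
  by (simp add: bilinear_def apply_W_comb sum.distrib sum_distrib_left algebra_simps)

lemma bilinear_comb_left: "bilinear (\<lambda>i. b i + t * c i) a = bilinear b a + t * bilinear c a"
  by (simp add: bilinear_commute[of _ a] bilinear_comb_right)

lemma bilinear_nonneg: "0 \<le> bilinear z z"
  using psd[of z] by (simp add: bilinear_def apply_W_def)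

lemma objective_comb:
  "objective (\<lambda>i. a i + t * b i) = objective a + t * (\<Sum>i\<le>n. b i * (apply_W a i + g i)) + t\<^sup>2 * bilinear b b / 2"
proof -
  have "(\<Sum>i\<le>n. b i * (apply_W a i + g i)) = bilinear b a + (\<Sum>i\<le>n. g i * b i)"
    by (simp add: bilinear_def sum.distrib algebra_simps)
  moreover have "(\<Sum>i\<le>n. g i * (a i + t * b i)) = (\<Sum>i\<le>n. g i * a i) + t * (\<Sum>i\<le>n. g i * b i)"
    by (simp add: sum.distrib sum_distrib_left algebra_simps)
  ultimately show ?thesis
    by (simp add: objective_def bilinear_comb_left bilinear_comb_right bilinear_commute[of a b] algebra_simps
        power2_eq_square add_divide_distrib)
qed

text \<open>
  For positive semidefinite W, an isotropic vector lies in the kernel.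
\<close>

lemma apply_W_eq_0_if_bilinear_eq_0:
  assumes "bilinear z z = 0" "i \<le> n"
  shows "apply_W z i = 0"
proof (rule ccontr)
  define e where "e = (\<lambda>k. if k = i then 1 else 0 :: real)"
  define w where "w = bilinear e e"
  have w: "0 \<le> w" by (simp add: w_def bilinear_nonneg)
  have ez: "bilinear e z = apply_W z i" using assms(2) by (simp add: bilinear_def e_def mult_delta)
  \<comment> \<open>the minimizing parameter is \<open>- apply_W z i / w\<close>; adding 1 covers \<open>w = 0\<close>\<close>
  define t where "t = - apply_W z i / (w + 1)"
  assume "apply_W z i \<noteq> 0"
  have "bilinear (\<lambda>k. z k + t * e k) (\<lambda>k. z k + t * e k) = 2 * t * apply_W z i + t\<^sup>2 * w"
    using assms(1) ez
    by (simp add: bilinear_comb_left bilinear_comb_right bilinear_commute[of z e] w_def power2_eq_square algebra_simps)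
  also have "\<dots> = - (apply_W z i)\<^sup>2 * (w + 2) / (w + 1)\<^sup>2"
    using w by (simp add: t_def power2_eq_square divide_simps) (simp add: algebra_simps)
  also have "\<dots> < 0" using w \<open>apply_W z i \<noteq> 0\<close> by (simp add: divide_simps zero_less_mult_iff)
  finally show False using bilinear_nonneg[of "\<lambda>k. z k + t * e k"] by simp
qed

text \<open>
  A nonnegative stationary point of the quadratic on the coordinate subspace of a nonsingular J.
\<close>

definition candidate :: "nat set \<Rightarrow> (nat \<Rightarrow> real) \<Rightarrow> bool" where
  "candidate J \<mu> \<longleftrightarrow> J \<subseteq> {..n} \<and> nonsingular_on n W J \<and> (\<forall>i. 0 \<le> \<mu> i) \<and>
     (\<forall>i. i \<notin> J \<longrightarrow> \<mu> i = 0) \<and> (\<forall>i\<in>J. apply_W \<mu> i + g i = 0)"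

lemma candidate_unique:
  assumes "candidate J \<mu>" "candidate J \<nu>"
  shows "\<mu> = \<nu>"
proof -
  have "\<forall>i\<in>J. apply_W (\<lambda>i. \<mu> i - \<nu> i) i = 0"
  proof
    fix i assume "i \<in> J"
    then have "apply_W \<mu> i + g i = 0" "apply_W \<nu> i + g i = 0" using assms by (auto simp: candidate_def)
    then show "apply_W (\<lambda>i. \<mu> i - \<nu> i) i = 0" unfolding apply_W_diff by simp
  qed
  moreover have "\<forall>i. i \<notin> J \<longrightarrow> \<mu> i - \<nu> i = 0"
    using assms by (auto simp: candidate_def)
  ultimately have "\<mu> i - \<nu> i = 0" for i
    using assms(1) nonsingular_onD[of n W J "\<lambda>i. \<mu> i - \<nu> i"] by (simp add: candidate_def apply_W_def)
  then show ?thesis by (intro ext) (simp add: algebra_simps)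
qed

text \<open>
  On a singular support there is a kernel direction along which the quadratic does not increase and
  some coordinate decreases.
\<close>

lemma singular_direction:
  assumes "K \<subseteq> {..n}" "\<not> nonsingular_on n W K"
  obtains z where "\<And>i. i \<notin> K \<Longrightarrow> z i = 0" "\<And>i. i \<le> n \<Longrightarrow> apply_W z i = 0"
    "(\<Sum>i\<le>n. g i * z i) \<le> 0" "\<exists>i\<in>K. z i < 0"
proof -
  obtain z where z: "\<And>i. i \<notin> K \<Longrightarrow> z i = 0" "\<And>i. i \<in> K \<Longrightarrow> apply_W z i = 0" "\<exists>i. z i \<noteq> 0"
    using assms(2) unfolding nonsingular_on_def apply_W_def by blast
  have "z i * apply_W z i = 0" for i using z(1,2)[of i] by (cases "i \<in> K") auto
  then have "bilinear z z = 0" by (simp add: bilinear_def)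
  then have app0: "apply_W z i = 0" if "i \<le> n" for i using apply_W_eq_0_if_bilinear_eq_0 that by blast
  have appm: "apply_W (\<lambda>i. - z i) k = - apply_W z k" for k by (simp add: apply_W_def sum_negf)
  have summ: "(\<Sum>i\<le>n. g i * - z i) = - (\<Sum>i\<le>n. g i * z i)" by (simp add: sum_negf)
  have neg: "(\<exists>i\<in>K. z i < 0) \<or> (\<forall>i. 0 \<le> z i)" "(\<exists>i\<in>K. - z i < 0) \<or> (\<forall>i. 0 \<le> - z i)"
    using z(1) by (metis less_eq_real_def linorder_not_less neg_less_0_iff_less neg_0_le_iff_le)+
  \<comment> \<open>If the sign of z that makes the linear part nonpositive is a nonnegative vector, then the
    linear part is zero and the opposite sign works.\<close>
  consider "(\<Sum>i\<le>n. g i * z i) \<le> 0" "\<exists>i\<in>K. z i < 0" | "(\<Sum>i\<le>n. g i * - z i) \<le> 0" "\<exists>i\<in>K. - z i < 0"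
  proof -
    have p: "0 \<le> (\<Sum>i\<le>n. g i * z i)" if "\<forall>i. 0 \<le> z i"
      using bounded_below[of z] that app0 by (simp add: apply_W_def)
    have q: "0 \<le> (\<Sum>i\<le>n. g i * - z i)" if "\<forall>i. 0 \<le> - z i"
      using bounded_below[of "\<lambda>i. - z i"] that app0 appm by (simp add: apply_W_def)
    have "\<not> ((\<forall>i. 0 \<le> z i) \<and> (\<forall>i. 0 \<le> - z i))"
      using z(3) by (metis neg_0_le_iff_le order_antisym)
    then consider "\<exists>i\<in>K. z i < 0" "\<exists>i\<in>K. - z i < 0"
      | "\<exists>i\<in>K. z i < 0" "\<forall>i. 0 \<le> - z i" | "\<forall>i. 0 \<le> z i" "\<exists>i\<in>K. - z i < 0"
      using neg by blast
    then show thesis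
    proof cases
      case 1
      then show thesis
        using that summ by (cases "(\<Sum>i\<le>n. g i * z i) \<le> 0") auto
    next
      case 2
      then have "(\<Sum>i\<le>n. g i * z i) \<le> 0" using q summ by simp
      then show thesis using that(1) 2(1) by blast
    next
      case 3
      then have "(\<Sum>i\<le>n. g i * - z i) \<le> 0" using p summ by simp
      then show thesis using that(2) 3(2) by blast
    qed
  qed
  then show thesis
  proof cases
    case 1
    then show thesis using that[of z] z(1) app0 by blast
  next
    case 2
    then show thesis using that[of "\<lambda>i. - z i"] z(1) app0 appm by simp
  qed
qed

lemma reduce_to_candidate:
  assumes "finite K" "K \<subseteq> {..n}" "\<And>i. 0 \<le> a i" "\<And>i. i \<notin> K \<Longrightarrow> a i = 0"
  shows "\<exists>J \<mu>. candidate J \<mu> \<and> objective \<mu> \<le> objective a"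
  using assms
proof (induction K arbitrary: a rule: finite_psubset_induct)
  case (psubset K)
  note K = psubset.prems(1) and a = psubset.prems(2) and aK = psubset.prems(3)
  have step: ?case
    if zK: "\<And>i. i \<notin> K \<Longrightarrow> z i = 0" and i: "i \<in> K" "z i < 0"
      and dec: "\<And>s. 0 \<le> s \<Longrightarrow> s \<le> a i / - z i \<Longrightarrow> objective (\<lambda>k. a k + s * z k) \<le> objective a" for z i
  proof -
    \<comment> \<open>move until the first coordinate vanishes, then recurse on the smaller support\<close>
    obtain i0 s where s: "i0 \<in> K" "z i0 < 0" "0 \<le> s" "a i0 + s * z i0 = 0"
      "\<And>k. k \<in> K \<Longrightarrow> 0 \<le> a k + s * z k" "s \<le> a i / - z i"
      using exists_first_hit[where K = K and a = a and z = z and i = i] psubset.hyps a i by blast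
    have "\<exists>J \<mu>. candidate J \<mu> \<and> objective \<mu> \<le> objective (\<lambda>k. a k + s * z k)"
    proof (rule psubset.IH[of "K - {i0}"])
      show "0 \<le> a k + s * z k" for k using s(5)[of k] zK[of k] aK[of k] by (cases "k \<in> K") auto
    qed (use s K zK aK in auto)
    then show ?thesis using dec[OF s(3,6)] by (meson order_trans)
  qed
  show ?case
  proof (cases "nonsingular_on n W K")
    case True
    obtain \<beta> where \<beta>: "\<And>i. i \<notin> K \<Longrightarrow> \<beta> i = 0" "\<And>i. i \<in> K \<Longrightarrow> apply_W \<beta> i = - g i"
      using solvable[OF K True, of "\<lambda>i. - g i"] unfolding apply_W_def by blast
    define z where "z = (\<lambda>i. \<beta> i - a i)"
    have z0: "z i = 0" if "i \<notin> K" for i using \<beta>(1) aK that by (simp add: z_def)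
    have "z i * (apply_W a i + g i) = - (z i * apply_W z i)" for i
      using z0[of i] \<beta>(2)[of i] by (cases "i \<in> K") (simp_all add: z_def apply_W_diff algebra_simps)
    then have slope: "(\<Sum>i\<le>n. z i * (apply_W a i + g i)) = - bilinear z z"
      by (simp add: bilinear_def sum_negf)
    have dec: "objective (\<lambda>k. a k + s * z k) \<le> objective a" if "0 \<le> s" "s \<le> 1" for s
    proof -
      have "objective (\<lambda>k. a k + s * z k) = objective a - s * (1 - s / 2) * bilinear z z"
        unfolding objective_comb slope by (simp add: algebra_simps power2_eq_square)
      moreover have "0 \<le> s * (1 - s / 2) * bilinear z z" using that bilinear_nonneg[of z] by simp
      ultimately show ?thesis by simp
    qed
    show ?thesis
    proof (cases "\<forall>i. 0 \<le> \<beta> i")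
      case nonneg: True
      have "objective \<beta> \<le> objective a" using dec[of 1] by (simp add: z_def)
      moreover have "candidate K \<beta>" using nonneg True K \<beta> by (simp add: candidate_def)
      ultimately show ?thesis by blast
    next
      case False
      then obtain i where "\<beta> i < 0" by (auto simp: not_le)
      then have i: "i \<in> K" "z i < 0" "a i / - z i \<le> 1"
        using \<beta>(1)[of i] a[of i] by (force, simp_all add: z_def divide_simps)
      show ?thesis by (rule step[of z i]) (use z0 i dec in auto)
    qed
  next
    case False
    then obtain z where z: "\<And>i. i \<notin> K \<Longrightarrow> z i = 0" "\<And>i. i \<le> n \<Longrightarrow> apply_W z i = 0"
      "(\<Sum>i\<le>n. g i * z i) \<le> 0" "\<exists>i\<in>K. z i < 0"
      using singular_direction[OF K] by blast
    then obtain i where i: "i \<in> K" "z i < 0" by blast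
    have za: "bilinear z a = 0" unfolding bilinear_commute[of z a] using z(2) by (simp add: bilinear_def)
    have "objective (\<lambda>k. a k + s * z k) \<le> objective a" if "0 \<le> s" for s
    proof -
      have "(\<Sum>i\<le>n. z i * (apply_W a i + g i)) = bilinear z a + (\<Sum>i\<le>n. g i * z i)"
        by (simp add: bilinear_def sum.distrib algebra_simps)
      moreover have "bilinear z z = 0" using z(2) by (simp add: bilinear_def)
      ultimately have "objective (\<lambda>k. a k + s * z k) = objective a + s * (\<Sum>i\<le>n. g i * z i)"
        by (simp add: objective_comb za)
      then show ?thesis using that z(3) by (simp add: mult_nonneg_nonpos)
    qed
    then show ?thesis using step[of z i] z(1) i by blast
  qed
qed

lemma complementary_solution_exists:
  "\<exists>J \<mu>. J \<subseteq> {..n} \<and> nonsingular_on n W J \<and> (\<forall>i. 0 \<le> \<mu> i) \<and> (\<forall>i. i \<notin> J \<longrightarrow> \<mu> i = 0) \<and>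
     (\<forall>i\<in>J. (\<Sum>k\<le>n. W i k * \<mu> k) + g i = 0) \<and> (\<forall>i\<le>n. 0 \<le> (\<Sum>k\<le>n. W i k * \<mu> k) + g i)"
proof -
  define C where "C = {J. \<exists>\<mu>. candidate J \<mu>}"
  define sol where "sol J = (SOME \<mu>. candidate J \<mu>)" for J
  have sol: "candidate J (sol J)" if "J \<in> C" for J
    using that unfolding C_def sol_def by (metis (mono_tags) mem_Collect_eq someI_ex)
  have "C \<subseteq> Pow {..n}" by (auto simp: C_def candidate_def)
  then have "finite C" by (rule finite_subset) simp
  moreover have "{} \<in> C"
  proof -
    have "candidate {} (\<lambda>_. 0)" by (simp add: candidate_def nonsingular_on_def)
    then show ?thesis by (auto simp: C_def)
  qed
  ultimately obtain J where J: "J \<in> C" and least: "\<And>J'. J' \<in> C \<Longrightarrow> objective (sol J) \<le> objective (sol J')"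
    using arg_min_if_finite[of C "\<lambda>J. objective (sol J)"] by (metis (no_types) empty_iff not_le)
  define \<mu> where "\<mu> = sol J"
  have \<mu>: "candidate J \<mu>" using sol J by (simp add: \<mu>_def)
  have "0 \<le> apply_W \<mu> i + g i" if i: "i \<le> n" for i
  proof (rule ccontr)
    define y where "y = apply_W \<mu> i + g i"
    assume "\<not> ?thesis"
    then have y: "y < 0" by (simp add: y_def)
    define e where "e = (\<lambda>k. if k = i then 1 else 0 :: real)"
    define w where "w = bilinear e e"
    have w: "0 \<le> w" by (simp add: w_def bilinear_nonneg)
    \<comment> \<open>a step that is short enough for the linear decrease to dominate\<close>
    define t where "t = - y / (w + 1)"
    have t: "0 < t" using y w by (simp add: t_def divide_simps)
    have "t * w \<le> t * (w + 1)" using t by simp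
    also have "t * (w + 1) = - y" using w by (simp add: t_def)
    finally have "t * w \<le> - y" .
    then have "y + t * w / 2 < 0" using y by simp
    then have "t * (y + t * w / 2) < 0" using t by (simp add: mult_pos_neg)
    moreover have "(\<Sum>k\<le>n. e k * (apply_W \<mu> k + g k)) = y"
      using i by (simp add: e_def y_def mult_delta)
    ultimately have less: "objective (\<lambda>k. \<mu> k + t * e k) < objective \<mu>"
      by (simp add: objective_comb w_def algebra_simps power2_eq_square)
    have Jn: "J \<subseteq> {..n}" using \<mu> by (simp add: candidate_def)
    obtain J' \<mu>' where c': "candidate J' \<mu>'" and le: "objective \<mu>' \<le> objective (\<lambda>k. \<mu> k + t * e k)"
    proof -
      have "\<exists>J \<mu>'. candidate J \<mu>' \<and> objective \<mu>' \<le> objective (\<lambda>k. \<mu> k + t * e k)"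
      proof (rule reduce_to_candidate[of "insert i J"])
        show "finite (insert i J)" using Jn finite_subset by auto
        show "0 \<le> \<mu> k + t * e k" for k using \<mu> t by (simp add: candidate_def e_def)
        show "\<mu> k + t * e k = 0" if "k \<notin> insert i J" for k using \<mu> that by (simp add: candidate_def e_def)
      qed (use Jn i in auto)
      then show thesis using that by blast
    qed
    have "J' \<in> C" using c' by (auto simp: C_def)
    then have "objective \<mu> \<le> objective \<mu>'"
      using least candidate_unique[OF c' sol] by (auto simp: \<mu>_def)
    then show False using le less by simp
  qed
  then show ?thesis using \<mu> unfolding candidate_def apply_W_def by blast
qed

end

section \<open>Principal submatrices\<close>

lemma pick_bij_betw:
  assumes "finite J"
  shows "bij_betw (pick J) {..<card J} J"
proof (rule bij_betw_byWitness[where f' = "\<lambda>j. card {a \<in> J. a < j}"])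
  show "\<forall>k\<in>{..<card J}. card {a \<in> J. a < pick J k} = k" by (simp add: card_pick_le)
  show "\<forall>j\<in>J. pick J (card {a \<in> J. a < j}) = j" by (simp add: pick_card_in_set)
  show "pick J ` {..<card J} \<subseteq> J" by (auto simp: pick_in_set_le)
  show "(\<lambda>j. card {a \<in> J. a < j}) ` J \<subseteq> {..<card J}"
    using assms by (auto intro!: psubset_card_mono)
qed

lemma pick_le_bound: "J \<subseteq> {..n} \<Longrightarrow> k < card J \<Longrightarrow> pick J k \<le> n"
  using pick_in_set_le by blast

lemma submatrix_principal_carrier:
  assumes "M \<in> carrier_mat (n + 1) (n + 1)" "J \<subseteq> {..n}"
  shows "submatrix M J J \<in> carrier_mat (card J) (card J)"
proof -
  have "{i. i < n + 1 \<and> i \<in> J} = J" using assms(2) by auto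
  then show ?thesis using assms(1) dim_submatrix[of M J J] by (intro carrier_matI) auto
qed

lemma extend_by_zero_index [simp]:
  "i \<le> n \<Longrightarrow> extend_by_zero n J x $ i = (if i \<in> J then x $ card {j \<in> J. j < i} else 0)"
  by (simp add: extend_by_zero_def)

lemma extend_by_zero_dim [simp]: "dim_vec (extend_by_zero n J x) = n + 1"
  by (simp add: extend_by_zero_def)

lemma extend_by_zero_pick:
  assumes "J \<subseteq> {..n}" "k < card J"
  shows "extend_by_zero n J x $ pick J k = x $ k"
  using assms pick_in_set_le[of k J] pick_le_bound[OF assms] by (simp add: card_pick_le)

lemma submatrix_mult_vec:
  assumes M: "M \<in> carrier_mat (n + 1) (n + 1)" and J: "J \<subseteq> {..n}"
    and x: "x \<in> carrier_vec (card J)" and k: "k < card J"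
  shows "(submatrix M J J *\<^sub>v x) $ k = (\<Sum>j\<le>n. M $$ (pick J k, j) * extend_by_zero n J x $ j)"
proof -
  have fin: "finite J" using J finite_subset by blast
  have dims: "{i. i < n + 1 \<and> i \<in> J} = J" using J by auto
  have A: "submatrix M J J $$ (k, l) = M $$ (pick J k, pick J l)" if "l < card J" for l
    using M dims k that by (intro submatrix_index) auto
  have "(submatrix M J J *\<^sub>v x) $ k = (\<Sum>l<card J. M $$ (pick J k, pick J l) * x $ l)"
    using submatrix_principal_carrier[OF M J] x k A
    by (auto simp: scalar_prod_def lessThan_atLeast0 intro!: sum.cong)
  also have "\<dots> = (\<Sum>l<card J. M $$ (pick J k, pick J l) * extend_by_zero n J x $ pick J l)"
    using extend_by_zero_pick[OF J] by simp
  also have "\<dots> = (\<Sum>j\<in>J. M $$ (pick J k, j) * extend_by_zero n J x $ j)"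
    by (rule sum.reindex_bij_betw[OF pick_bij_betw[OF fin]])
  also have "\<dots> = (\<Sum>j\<le>n. M $$ (pick J k, j) * extend_by_zero n J x $ j)"
    using J by (intro sum.mono_neutral_left) auto
  finally show ?thesis .
qed

lemma extend_by_zero_restrict:
  assumes "J \<subseteq> {..n}" "\<And>i. i \<notin> J \<Longrightarrow> z i = 0" "i \<le> n"
  shows "extend_by_zero n J (Matrix.vec (card J) (\<lambda>k. z (pick J k))) $ i = z i"
proof (cases "i \<in> J")
  case True
  have "finite J" using assms(1) finite_subset by blast
  then have "card {j \<in> J. j < i} < card J" using True by (auto intro!: psubset_card_mono)
  then show ?thesis using True assms(3) by (simp add: pick_card_in_set)
qed (use assms in simp)

lemma det_principal_submatrix_iff:
  assumes M: "M \<in> carrier_mat (n + 1) (n + 1)" and J: "J \<subseteq> {..n}"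
  shows "det (submatrix M J J) \<noteq> 0 \<longleftrightarrow> nonsingular_on n (\<lambda>i k. M $$ (i, k)) J"
proof -
  note A = submatrix_principal_carrier[OF M J]
  have fin: "finite J" using J finite_subset by blast
  have "(\<exists>x. x \<in> carrier_vec (card J) \<and> x \<noteq> 0\<^sub>v (card J) \<and> submatrix M J J *\<^sub>v x = 0\<^sub>v (card J)) \<longleftrightarrow>
    \<not> nonsingular_on n (\<lambda>i k. M $$ (i, k)) J" (is "?L \<longleftrightarrow> ?R")
  proof
    assume ?L
    then obtain x where x: "x \<in> carrier_vec (card J)" "x \<noteq> 0\<^sub>v (card J)"
      "submatrix M J J *\<^sub>v x = 0\<^sub>v (card J)" by blast
    define z where "z i = (if i \<in> J then extend_by_zero n J x $ i else 0)" for i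
    obtain k where k: "k < card J" "x $ k \<noteq> 0" 
      using x(1,2) eq_vecI[of x "0\<^sub>v (card J)"] by auto
    show ?R
    proof
      assume ns: "nonsingular_on n (\<lambda>i k. M $$ (i, k)) J"
      have "(\<Sum>k\<le>n. M $$ (i, k) * z k) = 0" if "i \<in> J" for i
      proof -
        obtain l where l: "l < card J" "i = pick J l"
          using bij_betw_imp_surj_on[OF pick_bij_betw[OF fin]] \<open>i \<in> J\<close> by auto
        have "(\<Sum>k\<le>n. M $$ (i, k) * z k) = (\<Sum>k\<le>n. M $$ (i, k) * extend_by_zero n J x $ k)"
          by (intro sum.cong) (auto simp: z_def)
        also have "\<dots> = 0" using submatrix_mult_vec[OF M J x(1) l(1)] x(3) l by simp
        finally show ?thesis .
      qed
      then have "z (pick J k) = 0"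
        by (rule nonsingular_onD[OF ns, where z = z, rotated]) (simp_all add: z_def)
      then show False
        using k extend_by_zero_pick[OF J k(1), of x] pick_in_set_le[of k J] by (simp add: z_def del: extend_by_zero_index)
    qed
  next
    assume ?R
    then obtain z i0 where z: "\<And>i. i \<notin> J \<Longrightarrow> z i = 0" "\<And>i. i \<in> J \<Longrightarrow> (\<Sum>k\<le>n. M $$ (i, k) * z k) = 0" "z i0 \<noteq> 0"
      unfolding nonsingular_on_def by blast
    define x where "x = Matrix.vec (card J) (\<lambda>k. z (pick J k))"
    have x: "x \<in> carrier_vec (card J)" by (simp add: x_def)
    note ext = extend_by_zero_restrict[where z = z, OF J z(1), folded x_def]
    have "i0 \<in> J" using z by blast
    then obtain l where l: "l < card J" "i0 = pick J l"
      using bij_betw_imp_surj_on[OF pick_bij_betw[OF fin]] by auto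
    have "x $ l \<noteq> 0" using l z(3) by (simp add: x_def)
    then have "x \<noteq> 0\<^sub>v (card J)" using l by auto
    moreover have "submatrix M J J *\<^sub>v x = 0\<^sub>v (card J)"
    proof (rule eq_vecI)
      fix k assume "k < dim_vec (0\<^sub>v (card J))"
      then have k: "k < card J" by simp
      have "(submatrix M J J *\<^sub>v x) $ k = (\<Sum>j\<le>n. M $$ (pick J k, j) * z j)"
        unfolding submatrix_mult_vec[OF M J x k] by (intro sum.cong refl) (use ext in auto)
      also have "\<dots> = 0" using z(2) pick_in_set_le[OF k] by blast
      finally show "(submatrix M J J *\<^sub>v x) $ k = 0\<^sub>v (card J) $ k" using k by simp
    qed (use A in auto)
    ultimately show ?L using x by blast
  qed
  then show ?thesis using det_0_iff_vec_prod_zero[OF A] by blast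
qed

lemma mat_inverse_exists:
  fixes A :: "real Matrix.mat"
  assumes "A \<in> carrier_mat N N" "det A \<noteq> 0"
  obtains B where "mat_inverse A = Some B" "A * B = 1\<^sub>m N" "B * A = 1\<^sub>m N" "B \<in> carrier_mat N N"
proof -
  have "mat_inverse A \<noteq> None"
    using det_non_zero_imp_unit[OF assms, of "()"] mat_inverse(1)[OF assms(1), of "()"] by blast
  then obtain B where "mat_inverse A = Some B" by blast
  then show thesis using that mat_inverse(2)[OF assms(1)] by blast
qed

lemma mat_inverse_solves:
  fixes A :: "real Matrix.mat"
  assumes A: "A \<in> carrier_mat N N" and det: "det A \<noteq> 0" and b: "b \<in> carrier_vec N"
  shows "the (mat_inverse A) *\<^sub>v b \<in> carrier_vec N"
    and "A *\<^sub>v (the (mat_inverse A) *\<^sub>v b) = b"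
proof -
  obtain B where B: "mat_inverse A = Some B" "A * B = 1\<^sub>m N" "B * A = 1\<^sub>m N" "B \<in> carrier_mat N N"
    using mat_inverse_exists[OF A det] .
  show "the (mat_inverse A) *\<^sub>v b \<in> carrier_vec N" using b B by auto
  have "A *\<^sub>v (B *\<^sub>v b) = (A * B) *\<^sub>v b" using A B b by (metis assoc_mult_mat_vec)
  then show "A *\<^sub>v (the (mat_inverse A) *\<^sub>v b) = b" using b B by simp
qed

lemma mat_inverse_solution_unique:
  fixes A :: "real Matrix.mat"
  assumes A: "A \<in> carrier_mat N N" and det: "det A \<noteq> 0" and x: "x \<in> carrier_vec N"
  shows "the (mat_inverse A) *\<^sub>v (A *\<^sub>v x) = x"
proof -
  obtain B where B: "mat_inverse A = Some B" "A * B = 1\<^sub>m N" "B * A = 1\<^sub>m N" "B \<in> carrier_mat N N"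
    using mat_inverse_exists[OF A det] .
  have "B *\<^sub>v (A *\<^sub>v x) = (B * A) *\<^sub>v x" using A B x by (metis assoc_mult_mat_vec)
  then show ?thesis using x B by simp
qed

lemma nonsingular_on_solvable:
  assumes M: "M \<in> carrier_mat (n + 1) (n + 1)" and J: "J \<subseteq> {..n}"
    and ns: "nonsingular_on n (\<lambda>i k. M $$ (i, k)) J"
  shows "\<exists>\<beta>. (\<forall>i. i \<notin> J \<longrightarrow> \<beta> i = 0) \<and> (\<forall>i\<in>J. (\<Sum>k\<le>n. M $$ (i, k) * \<beta> k) = h i)"
proof -
  note A = submatrix_principal_carrier[OF M J]
  have fin: "finite J" using J finite_subset by blast
  define b where "b = Matrix.vec (card J) (\<lambda>k. h (pick J k))"
  define x where "x = the (mat_inverse (submatrix M J J)) *\<^sub>v b"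
  have "det (submatrix M J J) \<noteq> 0" using det_principal_submatrix_iff[OF M J] ns by blast
  then have x: "x \<in> carrier_vec (card J)" "submatrix M J J *\<^sub>v x = b"
    using mat_inverse_solves[OF A, of b] by (auto simp: x_def b_def)
  define \<beta> where "\<beta> i = (if i \<in> J then extend_by_zero n J x $ i else 0)" for i
  have "(\<Sum>k\<le>n. M $$ (i, k) * \<beta> k) = h i" if "i \<in> J" for i
  proof -
    obtain l where l: "l < card J" "i = pick J l"
      using bij_betw_imp_surj_on[OF pick_bij_betw[OF fin]] \<open>i \<in> J\<close> by auto
    have "(\<Sum>k\<le>n. M $$ (i, k) * \<beta> k) = (\<Sum>k\<le>n. M $$ (i, k) * extend_by_zero n J x $ k)"
      by (intro sum.cong) (auto simp: \<beta>_def)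
    also have "\<dots> = h i" using submatrix_mult_vec[OF M J x(1) l(1)] x(2) l by (simp add: b_def)
    finally show ?thesis .
  qed
  then show ?thesis by (intro exI[of _ \<beta>]) (auto simp: \<beta>_def)
qed

section \<open>Bernstein coefficients and degree elevation\<close>

text \<open>
  The degree n Bernstein coefficients of \<open>x ^ l\<close> are \<open>(i choose l) / (n choose l)\<close>.
\<close>

lemma sum_binomial_Bernstein:
  "(\<Sum>i\<le>n. real (i choose l) * Bernstein n i x) = real (n choose l) * x ^ l"
proof (cases "l \<le> n")
  case False
  then show ?thesis by (simp add: binomial_eq_0)
next
  case True
  have "(\<Sum>i\<le>n. real (i choose l) * Bernstein n i x)
      = (\<Sum>i\<in>{l..n}. real (i choose l) * Bernstein n i x)"
    by (intro sum.mono_neutral_right) (auto simp: binomial_eq_0)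
  also have "\<dots> = (\<Sum>k\<in>{..n - l}. real ((k + l) choose l) * Bernstein n (k + l) x)"
    using True
    by (intro sum.reindex_bij_witness[of _ "\<lambda>k. k + l" "\<lambda>i. i - l"]) auto
  also have "\<dots> = (\<Sum>k\<le>n - l. real (n choose l) * x ^ l * (real ((n - l) choose k) * x ^ k * (1 - x) ^ (n - l - k)))"
  proof (intro sum.cong refl)
    fix k assume "k \<in> {..n - l}"
    then have k: "k + l \<le> n" using True by auto
    have "(n choose (k + l)) * ((k + l) choose l) = (n choose l) * ((n - l) choose k)"
      using choose_mult[of l "k + l" n] k by simp
    then have "real ((k + l) choose l) * real (n choose (k + l)) = real (n choose l) * real ((n - l) choose k)"
      by (metis mult.commute of_nat_mult)
    moreover have "n - (k + l) = n - l - k" by simp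
    ultimately show "real ((k + l) choose l) * Bernstein n (k + l) x =
        real (n choose l) * x ^ l * (real ((n - l) choose k) * x ^ k * (1 - x) ^ (n - l - k))"
      by (simp add: Bernstein_def power_add)
  qed
  also have "\<dots> = real (n choose l) * x ^ l * (x + (1 - x)) ^ (n - l)"
    unfolding binomial_ring sum_distrib_left by (simp add: mult.assoc)
  finally show ?thesis by simp
qed

lemma poly_eq_sum_coeff:
  fixes p :: "real poly"
  assumes "degree p \<le> m"
  shows "poly p x = (\<Sum>k\<le>m. poly.coeff p k * x ^ k)"
proof -
  have "poly p x = (\<Sum>k\<le>degree p. poly.coeff p k * x ^ k)" by (rule poly_altdef)
  also have "\<dots> = (\<Sum>k\<le>m. poly.coeff p k * x ^ k)"
    using assms by (intro sum.mono_neutral_left) (auto simp: coeff_eq_0)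
  finally show ?thesis .
qed

lemma Bernstein_representation_exists:
  fixes p :: "real poly"
  assumes "degree p \<le> m"
  obtains c where "\<And>x. poly p x = (\<Sum>i\<le>m. c i * Bernstein m i x)"
proof
  define c where "c i = (\<Sum>k\<le>m. poly.coeff p k / real (m choose k) * real (i choose k))" for i
  fix x
  have "(\<Sum>i\<le>m. c i * Bernstein m i x)
      = (\<Sum>i\<le>m. \<Sum>k\<le>m. poly.coeff p k / real (m choose k) * (real (i choose k) * Bernstein m i x))"
    by (simp add: c_def sum_distrib_right mult.assoc)
  also have "\<dots> = (\<Sum>k\<le>m. poly.coeff p k / real (m choose k) * (\<Sum>i\<le>m. real (i choose k) * Bernstein m i x))"
    by (subst sum.swap) (simp add: sum_distrib_left)
  also have "\<dots> = poly p x"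
    unfolding sum_binomial_Bernstein poly_eq_sum_coeff[OF assms] by (intro sum.cong) auto
  finally show "poly p x = (\<Sum>i\<le>m. c i * Bernstein m i x)" by simp
qed

lemma Bernstein_independent:
  assumes "\<And>x. (\<Sum>i\<le>m. c i * Bernstein m i x) = 0" "i \<le> m"
  shows "c i = 0"
proof -
  define Q where "Q = (\<Sum>i\<le>m. Polynomial.monom (c i * real (m choose i)) i)"
  have "poly Q t = 0" if t: "0 < t" for t
  proof -
    \<comment> \<open>this substitution turns a combination of Bernstein polynomials into a polynomial in t\<close>
    define x where "x = t / (1 + t)"
    have x: "1 - x = 1 / (1 + t)" "x = t / (1 + t)" using t by (simp_all add: x_def divide_simps)
    have "(1 + t) ^ m * Bernstein m i x = real (m choose i) * t ^ i" if "i \<le> m" for i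
    proof -
      have "(1 + t) ^ m = (1 + t) ^ i * (1 + t) ^ (m - i)" using that by (simp flip: power_add)
      then show ?thesis using t by (simp add: Bernstein_def x(1) power_divide) (simp add: x(2) power_divide)
    qed
    then have "poly Q t = (1 + t) ^ m * (\<Sum>i\<le>m. c i * Bernstein m i x)"
      unfolding Q_def poly_sum poly_monom sum_distrib_left
      by (intro sum.cong refl) (simp add: mult.assoc mult.left_commute)
    then show ?thesis using assms(1) by simp
  qed
  then have "{0<..} \<subseteq> {t. poly Q t = 0}" by auto
  then have "infinite {t. poly Q t = 0}" using infinite_Ioi[of "0::real"] finite_subset by blast
  then have "Q = 0" using poly_roots_finite by blast
  moreover have "poly.coeff Q i = c i * real (m choose i)"
    using assms(2) by (simp add: Q_def coeff_sum)
  ultimately show ?thesis using assms(2) by simp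
qed

lemma bernstein_coeffs_eqI:
  assumes "c \<in> carrier_vec (m + 1)" "\<And>x. poly p x = (\<Sum>i\<le>m. c $ i * Bernstein m i x)"
  shows "bernstein_coeffs m p = c"
  unfolding bernstein_coeffs_def
proof (rule the_equality)
  fix d assume d: "d \<in> carrier_vec (m + 1) \<and> (\<forall>x. poly p x = (\<Sum>i\<le>m. d $ i * Bernstein m i x))"
  have "(\<Sum>i\<le>m. (d $ i - c $ i) * Bernstein m i x) = 0" for x
  proof -
    have "(\<Sum>i\<le>m. (d $ i - c $ i) * Bernstein m i x) =
      (\<Sum>i\<le>m. d $ i * Bernstein m i x) - (\<Sum>i\<le>m. c $ i * Bernstein m i x)"
      by (simp add: left_diff_distrib sum_subtractf)
    also have "\<dots> = poly p x - poly p x" using d assms(2) by simp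
    finally show ?thesis by simp
  qed
  then have "d $ i - c $ i = 0" if "i \<le> m" for i
    using Bernstein_independent[where m = m and c = "\<lambda>i. d $ i - c $ i" and i = i] that by blast
  then show "d = c" using d assms(1) by (intro eq_vecI) auto
qed (use assms in blast)

lemma bernstein_coeffs_spec:
  assumes "degree p \<le> m"
  shows "bernstein_coeffs m p \<in> carrier_vec (m + 1)"
    and "poly p x = (\<Sum>i\<le>m. bernstein_coeffs m p $ i * Bernstein m i x)"
proof -
  obtain c where "\<And>x. poly p x = (\<Sum>i\<le>m. c i * Bernstein m i x)"
    using Bernstein_representation_exists[OF assms] by blast
  then have c: "\<And>x. poly p x = (\<Sum>i\<le>m. Matrix.vec (m + 1) c $ i * Bernstein m i x)" by simp
  then have eq: "bernstein_coeffs m p = Matrix.vec (m + 1) c" by (intro bernstein_coeffs_eqI) auto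
  show "bernstein_coeffs m p \<in> carrier_vec (m + 1)" by (simp add: eq)
  show "poly p x = (\<Sum>i\<le>m. bernstein_coeffs m p $ i * Bernstein m i x)" unfolding eq by (rule c)
qed

lemma bernstein_coeffs_index_eqI:
  assumes "\<And>x. poly p x = (\<Sum>i\<le>m. c i * Bernstein m i x)" "i \<le> m"
  shows "bernstein_coeffs m p $ i = c i"
proof -
  have "bernstein_coeffs m p = Matrix.vec (m + 1) c"
    by (rule bernstein_coeffs_eqI) (use assms in auto)
  then show ?thesis using assms(2) by simp
qed

lemma bernstein_coeffs_sum:
  assumes "finite S" "\<And>j. j \<in> S \<Longrightarrow> degree (f j) \<le> m" "i \<le> m"
  shows "bernstein_coeffs m (\<Sum>j\<in>S. Polynomial.smult (a j) (f j)) $ i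
      = (\<Sum>j\<in>S. a j * bernstein_coeffs m (f j) $ i)"
proof (rule bernstein_coeffs_index_eqI[OF _ assms(3)])
  fix x
  have "poly (\<Sum>j\<in>S. Polynomial.smult (a j) (f j)) x = (\<Sum>j\<in>S. a j * poly (f j) x)"
    by (simp add: poly_sum)
  also have "\<dots> = (\<Sum>j\<in>S. a j * (\<Sum>i\<le>m. bernstein_coeffs m (f j) $ i * Bernstein m i x))"
    using bernstein_coeffs_spec(2)[OF assms(2)] by simp
  also have "\<dots> = (\<Sum>i\<le>m. \<Sum>j\<in>S. a j * bernstein_coeffs m (f j) $ i * Bernstein m i x)"
    by (subst sum.swap) (simp add: sum_distrib_left mult.assoc)
  finally show "poly (\<Sum>j\<in>S. Polynomial.smult (a j) (f j)) x
      = (\<Sum>i\<le>m. (\<Sum>j\<in>S. a j * bernstein_coeffs m (f j) $ i) * Bernstein m i x)"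
    by (simp add: sum_distrib_right)
qed

lemma bernstein_coeffs_add:
  assumes "degree f \<le> m" "degree g \<le> m" "i \<le> m"
  shows "bernstein_coeffs m (f + g) $ i = bernstein_coeffs m f $ i + bernstein_coeffs m g $ i"
proof (rule bernstein_coeffs_index_eqI[OF _ assms(3)])
  fix x
  show "poly (f + g) x = (\<Sum>i\<le>m. (bernstein_coeffs m f $ i + bernstein_coeffs m g $ i) * Bernstein m i x)"
    by (simp add: bernstein_coeffs_spec(2)[OF assms(1)] bernstein_coeffs_spec(2)[OF assms(2)]
        distrib_right sum.distrib)
qed

lemma Bernstein_elevation:
  assumes "j \<le> m" "m \<le> n"
  shows "Bernstein m j x = (\<Sum>i\<le>n. E_mat m n $$ (i, j) * Bernstein n i x)"
proof -
  have "(\<Sum>i\<le>n. E_mat m n $$ (i, j) * Bernstein n i x) =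
    (\<Sum>i\<in>{j..j + (n - m)}. real (m choose j) * real ((n - m) choose (i - j)) * x ^ i * (1 - x) ^ (n - i))"
  proof (intro sum.mono_neutral_cong_right ballI)
    fix i assume "i \<in> {..n} - {j..j + (n - m)}"
    then show "E_mat m n $$ (i, j) * Bernstein n i x = 0"
      using assms by (auto simp: E_mat_def binomial_eq_0)
  qed (use assms in \<open>auto simp: E_mat_def Bernstein_def\<close>)
  also have "\<dots> = (\<Sum>l\<in>{..n - m}. real (m choose j) * real ((n - m) choose l) * x ^ (j + l) * (1 - x) ^ (n - (j + l)))"
    by (intro sum.reindex_bij_witness[of _ "\<lambda>l. j + l" "\<lambda>i. i - j"]) auto
  also have "\<dots> = (\<Sum>l\<le>n - m. Bernstein m j x * (real ((n - m) choose l) * x ^ l * (1 - x) ^ (n - m - l)))"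
  proof (intro sum.cong refl)
    fix l assume "l \<in> {..n - m}"
    then have "n - (j + l) = (m - j) + (n - m - l)" using assms by auto
    then show "real (m choose j) * real ((n - m) choose l) * x ^ (j + l) * (1 - x) ^ (n - (j + l)) =
      Bernstein m j x * (real ((n - m) choose l) * x ^ l * (1 - x) ^ (n - m - l))"
      by (simp add: Bernstein_def power_add)
  qed
  also have "\<dots> = Bernstein m j x * (x + (1 - x)) ^ (n - m)"
    unfolding binomial_ring sum_distrib_left by (simp add: mult.assoc)
  finally show ?thesis by simp
qed

lemma E_mat_carrier [simp]: "E_mat m n \<in> carrier_mat (n + 1) (m + 1)"
  by (simp add: E_mat_def)

lemma E_mat_mult_bernstein_coeffs:
  assumes q: "degree q \<le> m" and mn: "m \<le> n"
  shows "E_mat m n *\<^sub>v bernstein_coeffs m q = bernstein_coeffs n q"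
proof (rule bernstein_coeffs_eqI[symmetric])
  let ?c = "bernstein_coeffs m q"
  note c = bernstein_coeffs_spec[OF q]
  show "E_mat m n *\<^sub>v ?c \<in> carrier_vec (n + 1)"
    by (rule mult_mat_vec_carrier[OF E_mat_carrier c(1)])
  fix x
  have Ec: "(E_mat m n *\<^sub>v ?c) $ i = (\<Sum>j\<le>m. E_mat m n $$ (i, j) * ?c $ j)" if "i \<le> n" for i
    using that c(1) by (auto simp: E_mat_def scalar_prod_def lessThan_atLeast0 lessThan_Suc_atMost[symmetric] intro!: sum.cong)
  have "poly q x = (\<Sum>j\<le>m. ?c $ j * (\<Sum>i\<le>n. E_mat m n $$ (i, j) * Bernstein n i x))"
    unfolding c(2) by (intro sum.cong refl) (use Bernstein_elevation[OF _ mn] in auto)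
  also have "\<dots> = (\<Sum>i\<le>n. \<Sum>j\<le>m. E_mat m n $$ (i, j) * ?c $ j * Bernstein n i x)"
    unfolding sum_distrib_left by (subst sum.swap) (simp add: mult_ac)
  also have "\<dots> = (\<Sum>i\<le>n. (E_mat m n *\<^sub>v ?c) $ i * Bernstein n i x)"
    by (intro sum.cong refl) (simp add: Ec sum_distrib_right)
  finally show "poly q x = (\<Sum>i\<le>n. (E_mat m n *\<^sub>v ?c) $ i * Bernstein n i x)" .
qed

section \<open>The inner product on polynomials\<close>

text \<open>
  The integral over \<open>[0,1]\<close> and the inner product of \<open>L\<^sup>2(0,1)\<close>, for polynomials.
\<close>

definition integral01 :: "real poly \<Rightarrow> real" where
  "integral01 f = integral {0..1} (poly f)"

definition inner01 :: "real poly \<Rightarrow> real poly \<Rightarrow> real" where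
  "inner01 f g = integral01 (f * g)"

lemma poly_integrable: "poly f integrable_on {0..1::real}"
  by (intro integrable_continuous_interval continuous_intros)

lemma integral01_add: "integral01 (f + g) = integral01 f + integral01 g"
  unfolding integral01_def poly_add by (intro integral_add poly_integrable)

lemma integral01_smult: "integral01 (Polynomial.smult c f) = c * integral01 f"
  unfolding integral01_def poly_smult by (rule integral_mult_right)

lemma integral01_0: "integral01 0 = 0"
  using integral01_smult[of 0 0] by simp

lemma integral01_minus: "integral01 (- f) = - integral01 f"
  using integral01_smult[of "-1" f] by simp

lemma integral01_diff: "integral01 (f - g) = integral01 f - integral01 g"
  using integral01_add[of f "- g"] by (simp add: integral01_minus)

lemma integral01_pderiv: "integral01 (pderiv f) = poly f 1 - poly f 0"
  unfolding integral01_def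
  by (intro integral_unique fundamental_theorem_of_calculus)
    (auto simp flip: has_real_derivative_iff_has_vector_derivative intro!: DERIV_subset[OF poly_DERIV])

lemma inner01_commute: "inner01 f g = inner01 g f"
  by (simp add: inner01_def mult.commute)

lemma inner01_add_right: "inner01 f (g + h) = inner01 f g + inner01 f h"
  by (simp add: inner01_def distrib_left integral01_add)

lemma inner01_diff_right: "inner01 f (g - h) = inner01 f g - inner01 f h"
  by (simp add: inner01_def right_diff_distrib integral01_diff)

lemma inner01_smult_right: "inner01 f (Polynomial.smult c g) = c * inner01 f g"
  by (simp add: inner01_def integral01_smult)

lemma inner01_0_right: "inner01 f 0 = 0"
  by (simp add: inner01_def integral01_0)

lemma inner01_sum_right: "inner01 f (\<Sum>j\<in>S. g j) = (\<Sum>j\<in>S. inner01 f (g j))"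
  by (induction S rule: infinite_finite_induct) (auto simp: inner01_add_right inner01_0_right)

lemma inner01_add_left: "inner01 (g + h) f = inner01 g f + inner01 h f"
  by (simp add: inner01_commute[of _ f] inner01_add_right)

lemma inner01_diff_left: "inner01 (g - h) f = inner01 g f - inner01 h f"
  by (simp add: inner01_commute[of _ f] inner01_diff_right)

lemma inner01_smult_left: "inner01 (Polynomial.smult c g) f = c * inner01 g f"
  by (simp add: inner01_commute[of _ f] inner01_smult_right)

lemma inner01_sum_left: "inner01 (\<Sum>j\<in>S. g j) f = (\<Sum>j\<in>S. inner01 (g j) f)"
  by (simp add: inner01_commute[of _ f] inner01_sum_right)

lemma beta_integral:
  "integral01 ([:0, 1:] ^ a * [:1, -1:] ^ b) = fact a * fact b / fact (a + b + 1)"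
proof (induction b arbitrary: a)
  case 0
  have "integral01 (pderiv ([:0, 1:] ^ Suc a)) = 1" by (simp add: integral01_pderiv)
  moreover have "pderiv ([:0, 1:] ^ Suc a) = Polynomial.smult (real (a + 1)) ([:0, 1::real:] ^ a)"
    unfolding pderiv_power_Suc by (simp add: pderiv_pCons del: power_Suc)
  ultimately have "real (a + 1) * integral01 ([:0, 1:] ^ a) = 1" by (simp add: integral01_smult)
  then show ?case by (simp add: divide_simps mult.commute)
next
  case (Suc b)
  have "integral01 (pderiv ([:0, 1:] ^ Suc a * [:1, -1:] ^ Suc b)) = 0" by (simp add: integral01_pderiv)
  moreover have "pderiv ([:0, 1:] ^ Suc a * [:1, -1:] ^ Suc b) =
      Polynomial.smult (real (a + 1)) ([:0, 1:] ^ a * [:1, -1:] ^ Suc b)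
      - Polynomial.smult (real (b + 1)) ([:0, 1:] ^ Suc a * [:1, -1::real:] ^ b)"
    unfolding pderiv_mult pderiv_power_Suc by (simp add: pderiv_pCons mult_ac del: power_Suc)
  ultimately have "real (a + 1) * integral01 ([:0, 1:] ^ a * [:1, -1:] ^ Suc b)
      = real (b + 1) * integral01 ([:0, 1:] ^ Suc a * [:1, -1:] ^ b)"
    by (simp only: integral01_diff integral01_smult)
  also have "\<dots> = real (b + 1) * (fact (Suc a) * fact b / fact (Suc a + b + 1))"
    unfolding Suc.IH ..
  also have "\<dots> = real (a + 1) * (fact a * fact (Suc b) / fact (a + Suc b + 1))"
    by (simp add: algebra_simps)
  finally show ?case by (subst (asm) mult_left_cancel) auto
qed

section \<open>Legendre polynomials\<close>

lemma higher_pderiv_pcompose_affine: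
  "(pderiv ^^ j) (pcompose p [:-1, 2:]) = Polynomial.smult (2 ^ j) (pcompose ((pderiv ^^ j) p) [:-1, 2::real:])"
proof (induction j)
  case (Suc j)
  have "(pderiv ^^ Suc j) (pcompose p [:-1, 2:])
      = Polynomial.smult (2 ^ j) (pderiv (pcompose ((pderiv ^^ j) p) [:-1, 2:]))"
    by (simp add: Suc pderiv_smult)
  then show ?case by (simp add: pderiv_pcompose pderiv_pCons mult.commute)
qed simp

lemma legendre01_Rodrigues:
  "legendre01 j = Polynomial.smult (1 / fact j) ((pderiv ^^ j) ([:0, -1, 1:] ^ j))"
proof -
  have base: "pcompose [:-1, 0, 1:] [:-1, 2::real:] = Polynomial.smult 4 [:0, -1, 1:]"
    by (simp add: pcompose_pCons)
  have "pcompose ([:-1, 0, 1:] ^ j) [:-1, 2::real:] = Polynomial.smult (4 ^ j) ([:0, -1, 1:] ^ j)"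
  proof (induction j)
    case 0
    then show ?case by (simp add: pcompose_1)
  next
    case (Suc j)
    have "pcompose ([:-1, 0, 1:] ^ Suc j) [:-1, 2::real:] =
      pcompose [:-1, 0, 1:] [:-1, 2::real:] * pcompose ([:-1, 0, 1:] ^ j) [:-1, 2:]"
      by (simp only: power_Suc pcompose_mult)
    also have "\<dots> = Polynomial.smult (4 ^ Suc j) ([:0, -1, 1:] ^ Suc j)"
      unfolding Suc base power_Suc by (simp only: mult_smult_left mult_smult_right smult_smult mult.commute)
    finally show ?case .
  qed
  then have "Polynomial.smult (4 ^ j) ((pderiv ^^ j) ([:0, -1, 1:] ^ j))
      = Polynomial.smult (2 ^ j) (pcompose ((pderiv ^^ j) ([:-1, 0, 1:] ^ j)) [:-1, 2::real:])"
    using higher_pderiv_pcompose_affine[of j "[:-1, 0, 1:] ^ j"] by (simp add: higher_pderiv_smult)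
  from arg_cong[OF this, of "Polynomial.smult (1 / 2 ^ j)"]
  have eq: "pcompose ((pderiv ^^ j) ([:-1, 0, 1:] ^ j)) [:-1, 2::real:]
      = Polynomial.smult (4 ^ j / 2 ^ j) ((pderiv ^^ j) ([:0, -1, 1:] ^ j))"
    by simp
  have "(4::real) ^ j / 2 ^ j = 2 ^ j" by (simp flip: power_divide)
  then show ?thesis
    by (simp add: legendre01_def legendre_poly_def pcompose_smult eq divide_simps)
qed

lemma degree_x2_minus_x_power: "degree ([:0, -1, 1::real:] ^ j) = 2 * j"
  by (simp add: degree_power_eq)

lemma degree_legendre01: "degree (legendre01 j) = j"
  by (simp add: legendre01_Rodrigues degree_higher_pderiv degree_x2_minus_x_power)

lemma pochhammer_fact_quotient: "pochhammer (real (Suc a)) k = fact (a + k) / fact a"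
  by (induction k) (simp_all add: pochhammer_Suc algebra_simps)

lemma coeff_legendre01: "poly.coeff (legendre01 j) j = fact (2 * j) / (fact j)\<^sup>2"
proof -
  have "poly.coeff ([:0, -1, 1::real:] ^ j) (j + j) = 1"
    using lead_coeff_power[of "[:0, -1, 1::real:]" j] by (simp add: degree_x2_minus_x_power mult_2)
  then show ?thesis
    by (simp only: legendre01_Rodrigues coeff_smult coeff_higher_pderiv pochhammer_fact_quotient)
      (simp add: power2_eq_square mult_2)
qed

lemma power_dvd_pderiv:
  fixes w :: "real poly"
  assumes "w ^ Suc a dvd p"
  shows "w ^ a dvd pderiv p"
proof -
  obtain q where q: "p = w ^ Suc a * q" using assms by blast
  have "pderiv p = w ^ a * (w * pderiv q + Polynomial.smult (real (Suc a)) (pderiv w * q))"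
    unfolding q pderiv_mult pderiv_power_Suc
    by (simp add: distrib_left mult_ac del: of_nat_Suc)
  then show ?thesis by simp
qed

lemma power_dvd_higher_pderiv:
  fixes w :: "real poly"
  shows "k \<le> j \<Longrightarrow> w ^ (j - k) dvd (pderiv ^^ k) (w ^ j)"
proof (induction k)
  case (Suc k)
  then have "w ^ Suc (j - Suc k) dvd (pderiv ^^ k) (w ^ j)" by (simp add: Suc_diff_Suc)
  then show ?case using power_dvd_pderiv by auto
qed simp

lemma integral01_higher_pderiv_by_parts:
  assumes "\<And>k. k < j \<Longrightarrow> poly ((pderiv ^^ k) f) 0 = 0 \<and> poly ((pderiv ^^ k) f) 1 = 0"
  shows "integral01 ((pderiv ^^ j) f * g) = (-1) ^ j * integral01 (f * (pderiv ^^ j) g)"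
  using assms
proof (induction j arbitrary: g)
  case (Suc j)
  have "integral01 (pderiv ((pderiv ^^ j) f * g)) = 0" using Suc.prems[of j] by (simp add: integral01_pderiv)
  then have "integral01 ((pderiv ^^ Suc j) f * g) = - integral01 ((pderiv ^^ j) f * pderiv g)"
    by (simp add: pderiv_mult integral01_add mult_ac)
  also have "\<dots> = - ((-1) ^ j * integral01 (f * (pderiv ^^ j) (pderiv g)))"
    using Suc.IH[of "pderiv g"] Suc.prems by simp
  finally show ?case by (simp add: funpow_swap1)
qed simp

lemma inner01_legendre01:
  "inner01 (legendre01 j) g = (-1) ^ j / fact j * integral01 ([:0, -1, 1:] ^ j * (pderiv ^^ j) g)"
proof -
  have "poly ((pderiv ^^ k) ([:0, -1, 1:] ^ j)) c = 0" if "k < j" "c = 0 \<or> c = (1::real)" for k c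
  proof -
    have "[:0, -1, 1::real:] dvd [:0, -1, 1:] ^ (j - k)" using that(1) by (simp add: dvd_power)
    also have "\<dots> dvd (pderiv ^^ k) ([:0, -1, 1:] ^ j)" using that(1) by (simp add: power_dvd_higher_pderiv)
    finally show ?thesis using that(2) by (auto elim!: dvdE)
  qed
  then show ?thesis
    using integral01_higher_pderiv_by_parts[of j "[:0, -1, 1:] ^ j" g]
    by (simp add: inner01_def legendre01_Rodrigues integral01_smult)
qed

lemma higher_pderiv_eq_const:
  fixes g :: "real poly"
  assumes "degree g \<le> j"
  shows "(pderiv ^^ j) g = [:fact j * poly.coeff g j:]"
proof (rule poly_eqI)
  fix k
  show "poly.coeff ((pderiv ^^ j) g) k = poly.coeff [:fact j * poly.coeff g j:] k"
  proof (cases k)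
    case 0
    then show ?thesis by (simp add: coeff_higher_pderiv pochhammer_fact)
  next
    case (Suc k')
    then show ?thesis using assms by (simp add: coeff_higher_pderiv coeff_eq_0)
  qed
qed

text \<open>
  Integrating Rodrigues' formula by parts j times leaves only the coefficient of degree j of g; this
  gives both the orthogonality and the norm of the Legendre polynomials.
\<close>

lemma inner01_legendre01_of_degree_le:
  assumes "degree g \<le> j"
  shows "inner01 (legendre01 j) g = (fact j)\<^sup>2 / fact (2 * j + 1) * poly.coeff g j"
proof -
  have "[:0, -1, 1::real:] = Polynomial.smult (-1) ([:0, 1:] * [:1, -1:])" by simp
  then have "[:0, -1, 1::real:] ^ j = Polynomial.smult ((-1) ^ j) ([:0, 1:] ^ j * [:1, -1:] ^ j)"
    by (simp only: smult_power power_mult_distrib)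
  then have "[:0, -1, 1:] ^ j * (pderiv ^^ j) g
      = Polynomial.smult (fact j * poly.coeff g j * (-1) ^ j) ([:0, 1:] ^ j * [:1, -1:] ^ j)"
    unfolding higher_pderiv_eq_const[OF assms]
    by (simp only: mult_pCons_right mult_zero_right pCons_0_0 add_0_right smult_smult)
  then have integral01: "integral01 ([:0, -1, 1:] ^ j * (pderiv ^^ j) g)
      = fact j * poly.coeff g j * (-1) ^ j * (fact j * fact j / fact (2 * j + 1))"
    by (simp only: integral01_smult beta_integral mult_2)
  have cancel: "s / a * (a * c * s * (a * a / F)) = a\<^sup>2 / F * c"
    if "s * s = 1" "a \<noteq> 0" for s a c F :: real
  proof -
    have "s / a * (a * c * s * (a * a / F)) = (s * s) * (a\<^sup>2 / F * c)"
      using that(2) by (simp add: power2_eq_square)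
    then show ?thesis using that(1) by simp
  qed
  show ?thesis unfolding inner01_legendre01 integral01 by (rule cancel) simp_all
qed

text \<open>
  The orthonormal Legendre basis on \<open>[0,1]\<close>.
\<close>

definition onb :: "nat \<Rightarrow> real poly" where
  "onb j = Polynomial.smult (sqrt (2 * real j + 1)) (legendre01 j)"

lemma degree_onb: "degree (onb j) = j"
  by (simp add: onb_def degree_legendre01)

lemma inner01_onb_lower: "degree g < j \<Longrightarrow> inner01 (onb j) g = 0"
  by (simp add: onb_def inner01_smult_left inner01_legendre01_of_degree_le coeff_eq_0)

lemma inner01_onb: "inner01 (onb i) (onb j) = (if i = j then 1 else 0)"
proof -
  have "inner01 (legendre01 j) (legendre01 j) = 1 / (2 * real j + 1)"
    by (simp add: inner01_legendre01_of_degree_le degree_legendre01 coeff_legendre01)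
  then have "inner01 (onb j) (onb j) = 1"
    by (simp add: onb_def inner01_smult_left inner01_smult_right)
  moreover have "inner01 (onb i) (onb j) = 0" if "i \<noteq> j"
    using inner01_onb_lower[of "onb i" j] inner01_onb_lower[of "onb j" i] that
    by (cases i j rule: linorder_cases) (auto simp: degree_onb inner01_commute)
  ultimately show ?thesis by auto
qed

lemma onb_spans:
  assumes "degree q \<le> m"
  shows "\<exists>a. q = (\<Sum>j\<le>m. Polynomial.smult (a j) (onb j))"
  using assms
proof (induction m arbitrary: q)
  case 0
  have lc: "poly.coeff (onb 0) 0 \<noteq> 0"
    using degree_onb[of 0] coeff_legendre01[of 0] by (simp add: onb_def)
  obtain c where c: "q = [:c:]" using 0 degree_eq_zeroE by (metis le_zero_eq)
  obtain d where d: "onb 0 = [:d:]" using degree_onb[of 0] degree_eq_zeroE by blast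
  have "q = Polynomial.smult (c / d) (onb 0)" using lc c d by simp
  then show ?case by (intro exI[of _ "\<lambda>_. c / d"]) simp
next
  case (Suc m)
  have lc: "poly.coeff (onb (Suc m)) (Suc m) \<noteq> 0"
    using coeff_legendre01[of "Suc m"] by (simp add: onb_def)
  define b where "b = poly.coeff q (Suc m) / poly.coeff (onb (Suc m)) (Suc m)"
  define r where "r = q - Polynomial.smult b (onb (Suc m))"
  have "degree r \<le> m"
  proof (rule degree_le, intro allI impI)
    fix i assume i: "m < i"
    show "poly.coeff r i = 0"
    proof (cases "i = Suc m")
      case True
      then show ?thesis using lc by (simp add: r_def b_def)
    next
      case False
      then have "degree q < i" "degree (onb (Suc m)) < i" using i Suc.prems degree_onb[of "Suc m"] by linarith+
      then show ?thesis by (simp add: r_def coeff_eq_0)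
    qed
  qed
  then obtain a where a: "r = (\<Sum>j\<le>m. Polynomial.smult (a j) (onb j))" using Suc.IH by blast
  have "q = r + Polynomial.smult b (onb (Suc m))" by (simp add: r_def)
  also have "\<dots> = (\<Sum>j\<le>Suc m. Polynomial.smult ((a(Suc m := b)) j) (onb j))"
    by (simp add: a)
  finally show ?case by blast
qed

lemma inner01_onb_sum:
  assumes "finite S"
  shows "inner01 (onb k) (\<Sum>j\<in>S. Polynomial.smult (a j) (onb j)) = (if k \<in> S then a k else 0)"
proof -
  have "inner01 (onb k) (\<Sum>j\<in>S. Polynomial.smult (a j) (onb j)) = (\<Sum>j\<in>S. if j = k then a j else 0)"
    unfolding inner01_sum_right by (intro sum.cong refl) (simp add: inner01_smult_right inner01_onb)
  then show ?thesis using assms by simp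
qed

lemma onb_expansion:
  assumes "degree q \<le> m"
  shows "q = (\<Sum>j\<le>m. Polynomial.smult (inner01 (onb j) q) (onb j))"
proof -
  obtain a where a: "q = (\<Sum>j\<le>m. Polynomial.smult (a j) (onb j))" using onb_spans[OF assms] by blast
  have "inner01 (onb k) q = a k" if "k \<le> m" for k
    using that inner01_onb_sum[of "{..m}" k a] by (simp flip: a)
  then have "(\<Sum>j\<le>m. Polynomial.smult (inner01 (onb j) q) (onb j)) = (\<Sum>j\<le>m. Polynomial.smult (a j) (onb j))"
    by (intro sum.cong) auto
  then show ?thesis using a by simp
qed

lemma inner01_eq_sum_coordinates:
  assumes "degree q \<le> m"
  shows "inner01 q r = (\<Sum>j\<le>m. inner01 (onb j) q * inner01 (onb j) r)"
proof -
  have "inner01 q r = inner01 (\<Sum>j\<le>m. Polynomial.smult (inner01 (onb j) q) (onb j)) r"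
    by (rule arg_cong[OF onb_expansion[OF assms], of "\<lambda>q. inner01 q r"])
  then show ?thesis by (simp add: inner01_sum_left inner01_smult_left)
qed

lemma inner01_self_nonneg: "0 \<le> inner01 q q"
  unfolding inner01_eq_sum_coordinates[OF order_refl, of q q] by (intro sum_nonneg) simp

lemma inner01_self_eq_0:
  assumes "inner01 q q = 0"
  shows "q = 0"
proof -
  have "(\<Sum>j\<le>degree q. (inner01 (onb j) q)\<^sup>2) = 0"
    using assms inner01_eq_sum_coordinates[of q "degree q" q] by (simp add: power2_eq_square)
  then have "inner01 (onb j) q = 0" if "j \<le> degree q" for j
    using that by (subst (asm) sum_nonneg_eq_0_iff) auto
  then have "(\<Sum>j\<le>degree q. Polynomial.smult (inner01 (onb j) q) (onb j)) = 0" by simp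
  then show ?thesis using onb_expansion[of q "degree q"] by (metis order_refl)
qed

section \<open>The Bernstein-Durrmeyer operator\<close>

text \<open>
  Bernstein polynomials as elements of the polynomial type.
\<close>

definition bern :: "nat \<Rightarrow> nat \<Rightarrow> real poly" where
  "bern n i = Polynomial.smult (real (n choose i)) ([:0, 1:] ^ i * [:1, -1:] ^ (n - i))"

lemma poly_bern: "poly (bern n i) x = Bernstein n i x"
  by (simp add: bern_def Bernstein_def mult.assoc)

text \<open>
  The Bernstein-Durrmeyer operator without its usual factor \<open>n + 1\<close>; with this normalization the
  eigenvalues are exactly \<^const>\<open>lam\<close>.
\<close>

definition durrmeyer :: "nat \<Rightarrow> real poly \<Rightarrow> real poly" where
  "durrmeyer n f = (\<Sum>i\<le>n. Polynomial.smult (inner01 (bern n i) f) (bern n i))"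

lemma durrmeyer_sum:
  "durrmeyer n (\<Sum>l\<in>S. Polynomial.smult (a l) (f l)) = (\<Sum>l\<in>S. Polynomial.smult (a l) (durrmeyer n (f l)))"
proof (rule iffD1[OF poly_eq_poly_eq_iff], rule ext)
  fix x
  have "poly (durrmeyer n (\<Sum>l\<in>S. Polynomial.smult (a l) (f l))) x
      = (\<Sum>i\<le>n. \<Sum>l\<in>S. a l * (inner01 (bern n i) (f l) * poly (bern n i) x))"
    by (simp add: durrmeyer_def poly_sum inner01_sum_right inner01_smult_right sum_distrib_right mult.assoc)
  also have "\<dots> = poly (\<Sum>l\<in>S. Polynomial.smult (a l) (durrmeyer n (f l))) x"
    by (subst sum.swap) (simp add: durrmeyer_def poly_sum sum_distrib_left)
  finally show "poly (durrmeyer n (\<Sum>l\<in>S. Polynomial.smult (a l) (f l))) x = \<dots>" .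
qed

lemma inner01_durrmeyer_symmetric: "inner01 (durrmeyer n f) g = inner01 f (durrmeyer n g)"
  unfolding durrmeyer_def inner01_sum_left inner01_sum_right inner01_smult_left inner01_smult_right
  by (intro sum.cong refl) (simp add: inner01_commute[of f])

lemma inner01_bern_monom:
  assumes "i \<le> n"
  shows "inner01 (bern n i) (Polynomial.monom 1 k) = fact n * fact k / fact (n + k + 1) * real ((i + k) choose k)"
proof -
  have "bern n i * Polynomial.monom 1 k = Polynomial.smult (real (n choose i)) ([:0, 1:] ^ (i + k) * [:1, -1:] ^ (n - i))"
    by (simp only: bern_def power_add monom_altdef smult_1_left mult_smult_left mult_smult_right mult_ac)
  then have "inner01 (bern n i) (Polynomial.monom 1 k) = real (n choose i) * (fact (i + k) * fact (n - i) / fact (i + k + (n - i) + 1))"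
    by (simp only: inner01_def integral01_smult beta_integral)
  also have "i + k + (n - i) + 1 = n + k + 1" using assms by simp
  also have "real (n choose i) = fact n / (fact i * fact (n - i))" using assms by (simp add: binomial_fact)
  also have "fact (i + k) = fact i * fact k * real ((i + k) choose k)"
    using binomial_fact[of k "i + k", where 'a = real] by simp
  finally show ?thesis by (simp add: divide_simps)
qed

lemma durrmeyer_monom:
  "durrmeyer n (Polynomial.monom 1 k) = Polynomial.smult (fact n * fact k / fact (n + k + 1))
     (\<Sum>l\<le>k. Polynomial.monom (real (k choose l) * real (n choose l)) l)"
proof -
  define C where "C = (fact n * fact k / fact (n + k + 1) :: real)"
  have "poly (durrmeyer n (Polynomial.monom 1 k)) x = C * (\<Sum>l\<le>k. real (k choose l) * real (n choose l) * x ^ l)" for x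
  proof -
    have vm: "real ((i + k) choose k) = (\<Sum>l\<le>k. real (k choose l) * real (i choose l))" for i
    proof -
      have "(\<Sum>l\<le>k. (i choose l) * (k choose (k - l))) = (i + k) choose k" by (rule vandermonde)
      moreover have "(\<Sum>l\<le>k. (i choose l) * (k choose (k - l))) = (\<Sum>l\<le>k. (k choose l) * (i choose l))"
        by (intro sum.cong refl) (simp add: binomial_symmetric[symmetric])
      ultimately show ?thesis by (metis (no_types, lifting) of_nat_mult of_nat_sum sum.cong)
    qed
    have "poly (durrmeyer n (Polynomial.monom 1 k)) x = (\<Sum>i\<le>n. C * real ((i + k) choose k) * Bernstein n i x)"
      unfolding durrmeyer_def poly_sum poly_smult poly_bern C_def
      by (intro sum.cong refl) (simp add: inner01_bern_monom)
    also have "\<dots> = (\<Sum>i\<le>n. \<Sum>l\<le>k. C * (real (k choose l) * (real (i choose l) * Bernstein n i x)))"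
      unfolding vm by (simp add: sum_distrib_left sum_distrib_right mult_ac)
    also have "\<dots> = C * (\<Sum>l\<le>k. real (k choose l) * (\<Sum>i\<le>n. real (i choose l) * Bernstein n i x))"
      by (subst sum.swap) (simp add: sum_distrib_left)
    finally show ?thesis by (simp add: sum_binomial_Bernstein mult.assoc)
  qed
  then show ?thesis
    by (simp add: C_def poly_sum poly_monom flip: poly_eq_poly_eq_iff) (auto simp: poly_sum poly_monom)
qed

lemma coeff_durrmeyer_monom:
  "poly.coeff (durrmeyer n (Polynomial.monom 1 k)) l =
     (if l \<le> k then fact n * fact k / fact (n + k + 1) * (real (k choose l) * real (n choose l)) else 0)"
proof -
  have "poly.coeff (\<Sum>l\<le>k. Polynomial.monom (real (k choose l) * real (n choose l)) l) l
      = (\<Sum>l'\<le>k. if l' = l then real (k choose l) * real (n choose l) else 0)"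
    unfolding coeff_sum by (intro sum.cong refl) auto
  then show ?thesis by (simp add: durrmeyer_monom)
qed

lemma lam_eq: "j \<le> n \<Longrightarrow> lam n j = fact n * fact j / fact (n + j + 1) * real (n choose j)"
  by (simp add: lam_def binomial_fact power2_eq_square)

lemma lam_pos: "0 < lam n j"
  by (simp add: lam_def)

lemma durrmeyer_degree_and_coeff:
  assumes f: "degree f \<le> k" and k: "k \<le> n"
  shows "degree (durrmeyer n f) \<le> k" "poly.coeff (durrmeyer n f) k = lam n k * poly.coeff f k"
proof -
  have "f = (\<Sum>l\<le>k. Polynomial.smult (poly.coeff f l) (Polynomial.monom 1 l))"
    by (rule iffD1[OF poly_eq_poly_eq_iff], rule ext)
      (simp add: poly_sum poly_monom poly_eq_sum_coeff[OF f])
  then have eq: "durrmeyer n f = (\<Sum>l\<le>k. Polynomial.smult (poly.coeff f l) (durrmeyer n (Polynomial.monom 1 l)))"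
    using durrmeyer_sum[of n "poly.coeff f" "Polynomial.monom 1" "{..k}"] by simp
  have co: "poly.coeff (durrmeyer n f) r = (\<Sum>l\<le>k. poly.coeff f l * poly.coeff (durrmeyer n (Polynomial.monom 1 l)) r)" for r
    by (simp add: eq coeff_sum)
  show "degree (durrmeyer n f) \<le> k"
  proof (rule degree_le, intro allI impI)
    fix r assume "k < r"
    then show "poly.coeff (durrmeyer n f) r = 0"
      unfolding co by (intro sum.neutral) (auto simp: coeff_durrmeyer_monom)
  qed
  have "poly.coeff (durrmeyer n f) k = (\<Sum>l\<le>k. if l = k then lam n k * poly.coeff f k else 0)"
    unfolding co by (intro sum.cong refl) (use k in \<open>auto simp: coeff_durrmeyer_monom lam_eq\<close>)
  then show "poly.coeff (durrmeyer n f) k = lam n k * poly.coeff f k" by simp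
qed

text \<open>
  Subtracting \<open>lam n j * onb j\<close> cancels the coefficient of degree j, and by symmetry the difference is
  orthogonal to all polynomials of smaller degree, including itself.
\<close>

lemma durrmeyer_onb:
  assumes "j \<le> n"
  shows "durrmeyer n (onb j) = Polynomial.smult (lam n j) (onb j)"
proof -
  define r where "r = durrmeyer n (onb j) - Polynomial.smult (lam n j) (onb j)"
  have deg: "degree (onb j) \<le> j" by (simp add: degree_onb)
  note D = durrmeyer_degree_and_coeff[OF deg assms]
  have cj: "poly.coeff r j = 0" using D(2) by (simp add: r_def)
  have dr: "degree r \<le> j" unfolding r_def
    using D(1) deg by (intro degree_diff_le) (auto intro: order_trans[OF degree_smult_le])
  have "r = 0"
  proof (cases "degree r = j")
    case True
    then show ?thesis using cj by (metis leading_coeff_0_iff)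
  next
    case False
    then have less: "degree r < j" using dr by simp
    have "degree (durrmeyer n r) \<le> degree r"
      using durrmeyer_degree_and_coeff(1)[OF order_refl] less assms by simp
    then have "inner01 (onb j) (durrmeyer n r) = 0" using less by (intro inner01_onb_lower) simp
    then have "inner01 r r = 0"
      by (subst r_def) (simp add: inner01_diff_left inner01_smult_left inner01_durrmeyer_symmetric inner01_onb_lower[OF less])
    then show ?thesis by (rule inner01_self_eq_0)
  qed
  then show ?thesis by (simp add: r_def)
qed

lemma bernstein_coeffs_onb:
  assumes "j \<le> n" "i \<le> n"
  shows "bernstein_coeffs n (onb j) $ i = inner01 (bern n i) (onb j) / lam n j"
proof (rule bernstein_coeffs_index_eqI[OF _ assms(2)])
  fix x
  have "lam n j * poly (onb j) x = (\<Sum>i\<le>n. inner01 (bern n i) (onb j) * Bernstein n i x)"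
    using arg_cong[OF durrmeyer_onb[OF assms(1)], of "\<lambda>q. poly q x"]
    by (simp add: durrmeyer_def poly_sum poly_bern)
  then show "poly (onb j) x = (\<Sum>i\<le>n. inner01 (bern n i) (onb j) / lam n j * Bernstein n i x)"
    using lam_pos[of n j] by (simp add: sum_divide_distrib[symmetric] field_simps)
qed

text \<open>
  The relation \<open>U\<^sup>T U = diag (1 / lam n j)\<close>, applied to the coordinates of q.
\<close>

lemma bernstein_coeffs_onb_dot:
  assumes "j \<le> n" "degree q \<le> n"
  shows "(\<Sum>i\<le>n. bernstein_coeffs n (onb j) $ i * bernstein_coeffs n q $ i) = inner01 (onb j) q / lam n j"
proof -
  have q: "q = (\<Sum>i\<le>n. Polynomial.smult (bernstein_coeffs n q $ i) (bern n i))"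
    by (rule iffD1[OF poly_eq_poly_eq_iff], rule ext)
      (simp add: poly_sum poly_bern bernstein_coeffs_spec(2)[OF assms(2)])
  have "inner01 (onb j) q = (\<Sum>i\<le>n. bernstein_coeffs n q $ i * inner01 (bern n i) (onb j))"
    by (subst q) (simp add: inner01_sum_right inner01_smult_right inner01_commute[of "onb j"])
  then show ?thesis
    using bernstein_coeffs_onb[OF assms(1)] by (simp add: sum_divide_distrib mult.commute)
qed

section \<open>The matrices in the orthonormal basis\<close>

lemma bernstein_coeffs_smult:
  assumes "degree f \<le> n" "i \<le> n"
  shows "bernstein_coeffs n (Polynomial.smult c f) $ i = c * bernstein_coeffs n f $ i"
  using bernstein_coeffs_sum[of "{()}" "\<lambda>_. f" n i "\<lambda>_. c"] assms by simp

lemma bernstein_coeffs_eq_onb_sum: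
  assumes "degree r \<le> m" "m \<le> n" "i \<le> n"
  shows "bernstein_coeffs n r $ i = (\<Sum>j\<le>m. inner01 (onb j) r * bernstein_coeffs n (onb j) $ i)"
proof -
  have "bernstein_coeffs n (\<Sum>j\<le>m. Polynomial.smult (inner01 (onb j) r) (onb j)) $ i
      = (\<Sum>j\<le>m. inner01 (onb j) r * bernstein_coeffs n (onb j) $ i)"
    using assms by (intro bernstein_coeffs_sum) (auto simp: degree_onb)
  then show ?thesis by (simp flip: onb_expansion[OF assms(1)])
qed

lemma U_mat_carrier [simp]: "U_mat m n \<in> carrier_mat (n + 1) (m + 1)"
  by (rule carrier_matI) (simp_all add: U_mat_def)

lemma U_mat_index:
  assumes "i \<le> n" "j \<le> m" "m \<le> n"
  shows "U_mat m n $$ (i, j) = bernstein_coeffs n (onb j) $ i"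
proof -
  have d: "degree (legendre01 j) \<le> j" by (simp add: degree_legendre01)
  have jn: "j \<le> n" using assms by simp
  have E: "E_mat j n *\<^sub>v bernstein_coeffs j (legendre01 j) = bernstein_coeffs n (legendre01 j)"
    by (rule E_mat_mult_bernstein_coeffs[OF d jn])
  have c: "bernstein_coeffs n (legendre01 j) \<in> carrier_vec (n + 1)"
    using bernstein_coeffs_spec(1)[of "legendre01 j" n] d jn by simp
  have "U_mat m n $$ (i, j) = (sqrt (2 * real j + 1) \<cdot>\<^sub>v bernstein_coeffs n (legendre01 j)) $ i"
    using assms unfolding U_mat_def by (subst mat_of_cols_index) (simp_all add: E nth_append del: upt_Suc)
  also have "\<dots> = bernstein_coeffs n (onb j) $ i"
    using assms c d unfolding onb_def by (subst bernstein_coeffs_smult) auto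
  finally show ?thesis .
qed

text \<open>
  The matrix of the complementarity problem in which the coordinates j in S are free: half the Gram
  matrix of the rows of \<^const>\<open>U_mat\<close>, restricted to the columns in S. Entries are defined for all
  indices, but are meaningful only up to n.
\<close>

definition gram :: "nat \<Rightarrow> nat set \<Rightarrow> nat \<Rightarrow> nat \<Rightarrow> real" where
  "gram n S i k = (\<Sum>j\<in>S. bernstein_coeffs n (onb j) $ i * bernstein_coeffs n (onb j) $ k) / 2"

lemma W_mat_carrier [simp]: "W_mat m n \<in> carrier_mat (n + 1) (n + 1)"
  unfolding W_mat_def
  by (rule smult_carrier_mat[OF mult_carrier_mat[OF U_mat_carrier transpose_carrier_mat[THEN iffD2, OF U_mat_carrier]]])

lemma W_mat_index:
  assumes "i \<le> n" "k \<le> n" "m \<le> n"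
  shows "W_mat m n $$ (i, k) = gram n {..m} i k"
proof -
  have dims: "dim_row (U_mat m n) = n + 1" "dim_col (U_mat m n) = m + 1"
    using U_mat_carrier[of m n] by (metis carrier_matD)+
  have "W_mat m n $$ (i, k) = (1 / 2) * (\<Sum>j\<in>{0..<m + 1}. U_mat m n $$ (i, j) * U_mat m n $$ (k, j))"
    using assms by (simp add: W_mat_def dims scalar_prod_def)
  also have "{0..<m + 1} = {..m}" by auto
  also have "(\<Sum>j\<le>m. U_mat m n $$ (i, j) * U_mat m n $$ (k, j))
      = (\<Sum>j\<le>m. bernstein_coeffs n (onb j) $ i * bernstein_coeffs n (onb j) $ k)"
    using assms by (intro sum.cong refl) (simp add: U_mat_index)
  finally show ?thesis by (simp add: gram_def)
qed

lemma onb_0: "onb 0 = 1"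
  by (simp add: onb_def legendre01_Rodrigues)

lemma bernstein_coeffs_1: "i \<le> n \<Longrightarrow> bernstein_coeffs n 1 $ i = 1"
  by (rule bernstein_coeffs_index_eqI) simp_all

lemma gram_without_constant:
  assumes "i \<le> n" "k \<le> n"
  shows "gram n {1..m} i k = gram n {..m} i k - 1 / 2"
proof -
  have "{..m} = insert 0 {1..m}" by auto
  then show ?thesis using assms by (simp add: gram_def onb_0 bernstein_coeffs_1 add_divide_distrib)
qed

lemma mat_diag_mult_vec_index:
  fixes v :: "real Matrix.vec"
  assumes "v \<in> carrier_vec N" "j < N"
  shows "(mat_diag N f *\<^sub>v v) $ j = f j * v $ j"
proof -
  have "(mat_diag N f *\<^sub>v v) $ j = (\<Sum>k\<in>{0..<N}. (if j = k then f k else 0) * v $ k)"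
    using assms by (auto simp: mat_diag_def scalar_prod_def intro!: sum.cong)
  also have "\<dots> = (\<Sum>k\<in>{0..<N}. if j = k then f k * v $ k else 0)"
    by (intro sum.cong) auto
  finally show ?thesis using assms(2) by simp
qed

text \<open>
  The final step of both algorithms recovers a polynomial of degree at most m from its degree n
  Bernstein coefficients.
\<close>

lemma output_eq_bernstein_coeffs:
  assumes "degree q \<le> m" "m \<le> n"
  shows "U_mat m m *\<^sub>v (mat_diag (m + 1) (lam n) *\<^sub>v (transpose_mat (U_mat m n) *\<^sub>v bernstein_coeffs n q))
      = bernstein_coeffs m q"
proof -
  have qn: "degree q \<le> n" using assms by simp
  note c = bernstein_coeffs_spec(1)[OF qn]
  have dims: "dim_row (U_mat m n') = n' + 1" "dim_col (U_mat m n') = m + 1" for n'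
    using U_mat_carrier[of m n'] by (metis carrier_matD)+
  define a where "a = Matrix.vec (m + 1) (\<lambda>j. inner01 (onb j) q)"
  have U: "(transpose_mat (U_mat m n) *\<^sub>v bernstein_coeffs n q) $ j = inner01 (onb j) q / lam n j" if "j \<le> m" for j
  proof -
    have "(transpose_mat (U_mat m n) *\<^sub>v bernstein_coeffs n q) $ j
        = (\<Sum>i\<in>{0..<n + 1}. U_mat m n $$ (i, j) * bernstein_coeffs n q $ i)"
      using that c by (simp add: dims scalar_prod_def)
    also have "{0..<n + 1} = {..n}" by auto
    also have "(\<Sum>i\<le>n. U_mat m n $$ (i, j) * bernstein_coeffs n q $ i)
        = (\<Sum>i\<le>n. bernstein_coeffs n (onb j) $ i * bernstein_coeffs n q $ i)"
      using that assms by (intro sum.cong refl) (simp add: U_mat_index)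
    also have "\<dots> = inner01 (onb j) q / lam n j"
      using that assms qn by (intro bernstein_coeffs_onb_dot) auto
    finally show ?thesis .
  qed
  have diag: "mat_diag (m + 1) (lam n) *\<^sub>v (transpose_mat (U_mat m n) *\<^sub>v bernstein_coeffs n q) = a"
  proof (rule eq_vecI)
    fix j assume "j < dim_vec a"
    then have j: "j \<le> m" by (simp add: a_def)
    have "(mat_diag (m + 1) (lam n) *\<^sub>v (transpose_mat (U_mat m n) *\<^sub>v bernstein_coeffs n q)) $ j
        = lam n j * (transpose_mat (U_mat m n) *\<^sub>v bernstein_coeffs n q) $ j"
      using j by (intro mat_diag_mult_vec_index) (auto intro!: carrier_vecI simp: dims)
    also have "\<dots> = inner01 (onb j) q" using j lam_pos[of n j] U by simp
    finally show "(mat_diag (m + 1) (lam n) *\<^sub>v (transpose_mat (U_mat m n) *\<^sub>v bernstein_coeffs n q)) $ j = a $ j"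
      using j by (simp add: a_def)
  qed (simp add: a_def mat_diag_def)
  show ?thesis unfolding diag
  proof (rule eq_vecI)
    fix i assume "i < dim_vec (bernstein_coeffs m q)"
    then have i: "i \<le> m" using bernstein_coeffs_spec(1)[OF assms(1)] by simp
    have "(U_mat m m *\<^sub>v a) $ i = (\<Sum>j\<in>{0..<m + 1}. U_mat m m $$ (i, j) * a $ j)"
      using i by (simp add: dims scalar_prod_def a_def)
    also have "{0..<m + 1} = {..m}" by auto
    also have "(\<Sum>j\<le>m. U_mat m m $$ (i, j) * a $ j) = (\<Sum>j\<le>m. inner01 (onb j) q * bernstein_coeffs m (onb j) $ i)"
      using i by (intro sum.cong refl) (simp add: U_mat_index a_def)
    also have "\<dots> = bernstein_coeffs m q $ i"
      using bernstein_coeffs_eq_onb_sum[OF assms(1) order_refl i] by simp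
    finally show "(U_mat m m *\<^sub>v a) $ i = bernstein_coeffs m q $ i" .
  qed (use bernstein_coeffs_spec(1)[OF assms(1)] in \<open>simp add: dims\<close>)
qed

section \<open>Optimality conditions\<close>

text \<open>
  The feasible set of both problems: the coordinates outside S are those of p.
\<close>

definition feasible :: "nat \<Rightarrow> nat \<Rightarrow> nat set \<Rightarrow> real poly \<Rightarrow> real poly \<Rightarrow> bool" where
  "feasible m n S p q \<longleftrightarrow> q \<in> nonneg_poly_space m n \<and> (\<forall>j\<in>{..m} - S. inner01 (onb j) q = inner01 (onb j) p)"

lemma zero_vec_le_iff:
  fixes v :: "real Matrix.vec"
  shows "v \<in> carrier_vec N \<Longrightarrow> 0\<^sub>v N \<le> v \<longleftrightarrow> (\<forall>i<N. 0 \<le> v $ i)"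
  by (auto simp: less_eq_vec_def)

lemma nonneg_poly_space_iff:
  assumes "m \<le> n"
  shows "q \<in> nonneg_poly_space m n \<longleftrightarrow> degree q \<le> m \<and> (\<forall>i\<le>n. 0 \<le> bernstein_coeffs n q $ i)"
proof (cases "degree q \<le> m")
  case True
  then have "degree q \<le> n" using assms by simp
  then show ?thesis using True
    by (simp only: nonneg_poly_space_def poly_space_def E_mat_mult_bernstein_coeffs[OF True assms]
        zero_vec_le_iff[OF bernstein_coeffs_spec(1)] mem_Collect_eq) (simp add: less_Suc_eq_le)
qed (simp add: nonneg_poly_space_def poly_space_def)

text \<open>
  A minimizer together with the quadratic growth that expresses its optimality and uniqueness.
\<close>

definition strict_minimizer :: "nat \<Rightarrow> nat \<Rightarrow> nat set \<Rightarrow> real poly \<Rightarrow> real poly \<Rightarrow> bool" where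
  "strict_minimizer m n S p q0 \<longleftrightarrow> feasible m n S p q0 \<and>
     (\<forall>q. feasible m n S p q \<longrightarrow> inner01 (p - q0) (p - q0) + inner01 (q - q0) (q - q0) \<le> inner01 (p - q) (p - q))"

lemma strict_minimizer_unique:
  assumes "strict_minimizer m n S p q" "strict_minimizer m n S p r"
  shows "q = r"
proof -
  have "inner01 (p - q) (p - q) + inner01 (r - q) (r - q) \<le> inner01 (p - r) (p - r)"
    "inner01 (p - r) (p - r) + inner01 (q - r) (q - r) \<le> inner01 (p - q) (p - q)"
    using assms by (auto simp: strict_minimizer_def)
  then have "inner01 (q - r) (q - r) = 0" using inner01_self_nonneg[of "q - r"] inner01_self_nonneg[of "r - q"] by linarith
  then show ?thesis using inner01_self_eq_0 by fastforce
qed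

lemma L2_norm_poly: "L2_norm (poly f) = sqrt (inner01 f f)"
  by (simp add: L2_norm_def inner01_def integral01_def power2_eq_square poly_mult[abs_def])

lemma strict_minimizer_is_arg_min_iff:
  assumes "strict_minimizer m n S p q0"
  shows "is_arg_min (\<lambda>q. L2_norm (poly (p - q))) (feasible m n S p) q \<longleftrightarrow> q = q0"
proof
  have opt: "inner01 (p - q0) (p - q0) + inner01 (q - q0) (q - q0) \<le> inner01 (p - q) (p - q)" if "feasible m n S p q" for q
    using assms that by (simp add: strict_minimizer_def)
  have feas: "feasible m n S p q0" using assms by (simp add: strict_minimizer_def)
  {
    assume q: "is_arg_min (\<lambda>q. L2_norm (poly (p - q))) (feasible m n S p) q"
    then have "inner01 (p - q) (p - q) \<le> inner01 (p - q0) (p - q0)"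
      using feas by (auto simp: is_arg_min_def L2_norm_poly not_less)
    moreover have "feasible m n S p q" using q by (simp add: is_arg_min_def)
    ultimately have "inner01 (q - q0) (q - q0) = 0"
      using opt[of q] inner01_self_nonneg[of "q - q0"] by linarith
    then show "q = q0" using inner01_self_eq_0 by fastforce
  next
    assume "q = q0"
    then show "is_arg_min (\<lambda>q. L2_norm (poly (p - q))) (feasible m n S p) q"
      using feas opt inner01_self_nonneg[of "_ - q0"]
      by (auto simp: is_arg_min_def L2_norm_poly not_less intro: order_trans[OF add_increasing2 opt])
  }
qed

text \<open>
  Sufficiency of the Karush-Kuhn-Tucker conditions. With \<open>D = q0 - p\<close> the inner product of D and
  \<open>q - q0\<close> equals \<open>\<mu> \<bullet> (coefficients of q - y) / 2\<close>, which is nonnegative for feasible q by complementarity.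
\<close>

lemma KKT_strict_minimizer:
  assumes S: "S \<subseteq> {..m}" and mn: "m \<le> n" and p: "degree p \<le> m"
    and \<mu>: "\<And>i. i \<le> n \<Longrightarrow> 0 \<le> \<mu> i"
    and y: "\<And>i. i \<le> n \<Longrightarrow> y i = (\<Sum>k\<le>n. gram n S i k * \<mu> k) + bernstein_coeffs n p $ i"
    and y_nonneg: "\<And>i. i \<le> n \<Longrightarrow> 0 \<le> y i"
    and compl: "\<And>i. i \<le> n \<Longrightarrow> \<mu> i * y i = 0"
  obtains q0 where "strict_minimizer m n S p q0" "degree q0 \<le> m"
    "\<And>i. i \<le> n \<Longrightarrow> bernstein_coeffs n q0 $ i = y i"
proof -
  let ?u = "\<lambda>i j. bernstein_coeffs n (onb j) $ i"
  have fin: "finite S" using S finite_subset by blast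
  define d where "d j = (\<Sum>i\<le>n. \<mu> i * ?u i j) / 2" for j
  define D where "D = (\<Sum>j\<in>S. Polynomial.smult (d j) (onb j))"
  define q0 where "q0 = p + D"
  have degD: "degree D \<le> m"
    unfolding D_def using S fin
    by (intro degree_sum_le) (auto intro: order_trans[OF degree_smult_le] simp: degree_onb)
  have deg: "degree q0 \<le> m" unfolding q0_def using p degD by (rule degree_add_le)
  have coeffs: "bernstein_coeffs n q0 $ i = y i" if i: "i \<le> n" for i
  proof -
    have "bernstein_coeffs n q0 $ i = bernstein_coeffs n p $ i + bernstein_coeffs n D $ i"
      unfolding q0_def using p degD mn i by (intro bernstein_coeffs_add) auto
    moreover have "bernstein_coeffs n D $ i = (\<Sum>j\<in>S. d j * ?u i j)"
      unfolding D_def using fin S mn i by (intro bernstein_coeffs_sum) (auto simp: degree_onb)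
    moreover have "(\<Sum>j\<in>S. d j * ?u i j) = (\<Sum>k\<le>n. gram n S i k * \<mu> k)"
    proof -
      have "(\<Sum>j\<in>S. d j * ?u i j) = (\<Sum>j\<in>S. \<Sum>k\<le>n. \<mu> k * ?u k j * ?u i j / 2)"
        by (simp add: d_def sum_distrib_right sum_divide_distrib)
      also have "\<dots> = (\<Sum>k\<le>n. gram n S i k * \<mu> k)"
        by (subst sum.swap) (simp add: gram_def sum_distrib_left sum_distrib_right sum_divide_distrib mult_ac)
      finally show ?thesis .
    qed
    ultimately show ?thesis using y[OF i] by simp
  qed
  have feas: "feasible m n S p q0"
    unfolding feasible_def nonneg_poly_space_iff[OF mn]
  proof (intro conjI allI impI ballI)
    fix j assume "j \<in> {..m} - S"
    then show "inner01 (onb j) q0 = inner01 (onb j) p"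
      using inner01_onb_sum[OF fin, of j d] by (simp add: q0_def inner01_add_right D_def)
  qed (use deg coeffs y_nonneg in auto)
  have "inner01 (p - q0) (p - q0) + inner01 (q - q0) (q - q0) \<le> inner01 (p - q) (p - q)" if q: "feasible m n S p q" for q
  proof -
    have dq: "degree q \<le> m" and q_nonneg: "\<And>i. i \<le> n \<Longrightarrow> 0 \<le> bernstein_coeffs n q $ i"
      and q_fix: "\<And>j. j \<in> {..m} - S \<Longrightarrow> inner01 (onb j) q = inner01 (onb j) p"
      using q by (auto simp: feasible_def nonneg_poly_space_iff[OF mn])
    have q0_fix: "\<And>j. j \<in> {..m} - S \<Longrightarrow> inner01 (onb j) q0 = inner01 (onb j) p"
      using feas by (auto simp: feasible_def)
    have diff: "(\<Sum>j\<in>S. inner01 (onb j) (q - q0) * ?u i j) = bernstein_coeffs n q $ i - y i" if i: "i \<le> n" for i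
    proof -
      have "bernstein_coeffs n q $ i - y i = (\<Sum>j\<le>m. inner01 (onb j) (q - q0) * ?u i j)"
        unfolding coeffs[OF i, symmetric] bernstein_coeffs_eq_onb_sum[OF dq mn i] bernstein_coeffs_eq_onb_sum[OF deg mn i]
        by (simp add: inner01_diff_right left_diff_distrib sum_subtractf)
      also have "\<dots> = (\<Sum>j\<in>S. inner01 (onb j) (q - q0) * ?u i j)"
        using S q_fix q0_fix by (intro sum.mono_neutral_right) (auto simp: inner01_diff_right)
      finally show ?thesis by simp
    qed
    have "inner01 D (q - q0) = (\<Sum>j\<in>S. \<Sum>i\<le>n. \<mu> i * (inner01 (onb j) (q - q0) * ?u i j) / 2)"
      by (simp add: D_def inner01_sum_left inner01_smult_left d_def sum_distrib_left sum_distrib_right sum_divide_distrib mult_ac)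
    also have "\<dots> = (\<Sum>i\<le>n. \<mu> i * (\<Sum>j\<in>S. inner01 (onb j) (q - q0) * ?u i j) / 2)"
      by (subst sum.swap) (simp add: sum_distrib_left sum_divide_distrib)
    also have "\<dots> = (\<Sum>i\<le>n. \<mu> i * bernstein_coeffs n q $ i / 2)"
      by (intro sum.cong refl) (use diff compl in \<open>auto simp: right_diff_distrib\<close>)
    also have "\<dots> \<ge> 0" using \<mu> q_nonneg by (intro sum_nonneg) auto
    finally have cross: "0 \<le> inner01 D (q - q0)" .
    have "p - q = - D - (q - q0)" by (simp add: q0_def)
    then have "inner01 (p - q) (p - q) = inner01 (- D) (- D) + inner01 (q - q0) (q - q0) - 2 * inner01 (- D) (q - q0)"
      by (simp only: inner01_diff_left inner01_diff_right) (simp add: inner01_commute)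
    moreover have "inner01 (- D) (q - q0) = - inner01 D (q - q0)"
      using inner01_smult_left[of "-1" D "q - q0"] by simp
    moreover have "p - q0 = - D" by (simp add: q0_def)
    ultimately show ?thesis using cross by simp
  qed
  then show thesis using that[of q0] feas deg coeffs by (simp add: strict_minimizer_def)
qed

section \<open>The loop over subsets\<close>

lemma subset_loop_returned:
  fixes m n p A form_y
  defines "sol \<equiv> \<lambda>J. the (mat_inverse (A J)) *\<^sub>v subvector (- (E_mat m n *\<^sub>v bernstein_coeffs m p)) J"
  defines "out \<equiv> \<lambda>J. form_y (extend_by_zero n J (sol J))"
  defines "accept \<equiv> \<lambda>J. vec_space.rank (card J) (A J) = card J \<and> 0\<^sub>v (card J) \<le> sol J \<and> 0\<^sub>v (n + 1) \<le> out J"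
  assumes "\<exists>J\<in>set Js. accept J"
    and "\<And>J. J \<in> set Js \<Longrightarrow> accept J \<Longrightarrow>
      U_mat m m *\<^sub>v (mat_diag (m + 1) (lam n) *\<^sub>v (transpose_mat (U_mat m n) *\<^sub>v out J)) = r"
  shows "returned (subset_loop m n p A form_y c Js) = Some r"
  using assms(4,5)
proof (induction Js)
  case (Cons J Js)
  show ?case
  proof (cases "accept J")
    case True
    then show ?thesis using Cons.prems(2)[of J]
      by (simp add: Let_def accept_def out_def sol_def)
  next
    case False
    then have "returned (subset_loop m n p A form_y c Js) = Some r"
      using Cons by auto
    then show ?thesis using False by (auto simp: Let_def accept_def out_def sol_def)
  qed
qed simp

lemma subset_loop_operations_le:
  "operations (subset_loop m n p A form_y c Js)
     \<le> real (nonneg_solutions (subset_loop m n p A form_y c Js)) * c + q_cost m n + sum_list (map solve_cost Js)"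
proof (induction Js)
  case Nil
  show ?case by (simp add: q_cost_def)
next
  case (Cons J Js)
  have "0 \<le> sum_list (map solve_cost Js)"
    by (rule sum_list_nonneg) (auto simp: solve_cost_def)
  then show ?case using Cons by (simp add: Let_def distrib_right)
qed

lemma sum_Pow_insert_card:
  fixes f :: "nat \<Rightarrow> real"
  assumes "finite A" "a \<notin> A"
  shows "(\<Sum>J\<in>Pow (insert a A). f (card J)) = (\<Sum>J\<in>Pow A. f (card J) + f (card J + 1))"
proof -
  have "(\<Sum>J\<in>Pow (insert a A). f (card J)) = (\<Sum>J\<in>Pow A. f (card J)) + (\<Sum>J\<in>insert a ` Pow A. f (card J))"
    unfolding Pow_insert using assms by (intro sum.union_disjoint) auto
  also have "(\<Sum>J\<in>insert a ` Pow A. f (card J)) = (\<Sum>J\<in>Pow A. f (card (insert a J)))"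
    using assms(2) by (intro sum.reindex_cong[of "insert a"]) (auto simp: inj_on_def)
  also have "\<dots> = (\<Sum>J\<in>Pow A. f (card J + 1))"
  proof (intro sum.cong refl)
    fix J assume "J \<in> Pow A"
    then have "finite J" "a \<notin> J" using assms finite_subset by auto
    then show "f (card (insert a J)) = f (card J + 1)" by simp
  qed
  finally show ?thesis by (simp add: sum.distrib)
qed

lemma sum_Pow_card_power:
  assumes "finite A"
  shows "(\<Sum>J\<in>Pow A. real (card J)) = real (card A) * 2 ^ card A / 2"
    and "(\<Sum>J\<in>Pow A. real (card J) ^ 2) = real (card A) * (real (card A) + 1) * 2 ^ card A / 4"
    and "(\<Sum>J\<in>Pow A. real (card J) ^ 3) = real (card A) ^ 2 * (real (card A) + 3) * 2 ^ card A / 8"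
proof -
  have "(\<Sum>J\<in>Pow A. real (card J)) = real (card A) * 2 ^ card A / 2 \<and>
    (\<Sum>J\<in>Pow A. real (card J) ^ 2) = real (card A) * (real (card A) + 1) * 2 ^ card A / 4 \<and>
    (\<Sum>J\<in>Pow A. real (card J) ^ 3) = real (card A) ^ 2 * (real (card A) + 3) * 2 ^ card A / 8"
    using assms
  proof (induction A rule: finite_induct)
    case (insert a A)
    have 0: "(\<Sum>J\<in>Pow A. 1) = (2::real) ^ card A" using insert(1) by (simp add: card_Pow)
    have 2: "real (k + 1) ^ 2 = real k ^ 2 + 2 * real k + 1" for k by (simp add: power2_eq_square algebra_simps)
    have 3: "real (k + 1) ^ 3 = real k ^ 3 + 3 * real k ^ 2 + 3 * real k + 1" for k
      by (simp add: power2_eq_square power3_eq_cube algebra_simps)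
    note IH = insert.IH
    have "(\<Sum>J\<in>Pow (insert a A). real (card J)) = (\<Sum>J\<in>Pow A. 2 * real (card J) + 1)"
      using sum_Pow_insert_card[OF insert(1,2), of real] by simp
    also have "\<dots> = 2 * (\<Sum>J\<in>Pow A. real (card J)) + (\<Sum>J\<in>Pow A. 1)"
      unfolding sum.distrib by (simp only: sum_distrib_left)
    finally have s1: "(\<Sum>J\<in>Pow (insert a A). real (card J)) = \<dots>" .
    have "(\<Sum>J\<in>Pow (insert a A). real (card J) ^ 2) = (\<Sum>J\<in>Pow A. 2 * real (card J) ^ 2 + 2 * real (card J) + 1)"
      unfolding sum_Pow_insert_card[OF insert(1,2), of "\<lambda>k. real k ^ 2"] 2 by (intro sum.cong) auto
    also have "\<dots> = 2 * (\<Sum>J\<in>Pow A. real (card J) ^ 2) + 2 * (\<Sum>J\<in>Pow A. real (card J)) + (\<Sum>J\<in>Pow A. 1)"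
      unfolding sum.distrib by (simp only: sum_distrib_left)
    finally have s2: "(\<Sum>J\<in>Pow (insert a A). real (card J) ^ 2) = \<dots>" .
    have "(\<Sum>J\<in>Pow (insert a A). real (card J) ^ 3)
        = (\<Sum>J\<in>Pow A. 2 * real (card J) ^ 3 + 3 * real (card J) ^ 2 + 3 * real (card J) + 1)"
      unfolding sum_Pow_insert_card[OF insert(1,2), of "\<lambda>k. real k ^ 3"] 3 by (intro sum.cong) auto
    also have "\<dots> = 2 * (\<Sum>J\<in>Pow A. real (card J) ^ 3) + 3 * (\<Sum>J\<in>Pow A. real (card J) ^ 2)
        + 3 * (\<Sum>J\<in>Pow A. real (card J)) + (\<Sum>J\<in>Pow A. 1)"
      unfolding sum.distrib by (simp only: sum_distrib_left)
    finally have s3: "(\<Sum>J\<in>Pow (insert a A). real (card J) ^ 3) = \<dots>" .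
    have c: "real (card (insert a A)) = real (card A) + 1" "(2::real) ^ card (insert a A) = 2 * 2 ^ card A"
      using insert(1,2) by simp_all
    show ?case unfolding s1 s2 s3 0 IH[THEN conjunct1] IH[THEN conjunct2, THEN conjunct1]
        IH[THEN conjunct2, THEN conjunct2] c
      by (simp add: field_simps power2_eq_square)
  qed simp
  then show "(\<Sum>J\<in>Pow A. real (card J)) = real (card A) * 2 ^ card A / 2"
    "(\<Sum>J\<in>Pow A. real (card J) ^ 2) = real (card A) * (real (card A) + 1) * 2 ^ card A / 4"
    "(\<Sum>J\<in>Pow A. real (card J) ^ 3) = real (card A) ^ 2 * (real (card A) + 3) * 2 ^ card A / 8"
    by blast+
qed

lemma total_solve_cost:
  assumes "distinct Js" "set Js = Pow {0..n}"
  shows "sum_list (map solve_cost Js) = 2 powi (int n - 1) / 3 * (real n + 1)\<^sup>2 * (real n + 4)"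
proof -
  have "sum_list (map solve_cost Js) = (\<Sum>J\<in>Pow {0..n}. 2 / 3 * real (card J) ^ 3)"
    using assms by (simp add: sum_list_distinct_conv_sum_set solve_cost_def)
  also have "\<dots> = 2 / 3 * (\<Sum>J\<in>Pow {0..n}. real (card J) ^ 3)"
    by (simp only: sum_distrib_left)
  also have "\<dots> = 2 / 3 * ((real n + 1) ^ 2 * (real n + 4) * (2 * 2 ^ n) / 8)"
    by (simp add: sum_Pow_card_power(3) algebra_simps)
  also have "\<dots> = 2 powi (int n - 1) / 3 * (real n + 1)\<^sup>2 * (real n + 4)"
    by (simp add: power_int_diff)
  finally show ?thesis .
qed

section \<open>Correctness of the algorithms\<close>

text \<open>
  The last premise makes the linear part nonnegative on nonnegative kernel vectors: such a vector
  annihilates the columns in S, and only the fixed coordinates of p contribute.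
\<close>

lemma complementary_solution_gram:
  assumes S: "S \<subseteq> {..m}" and mn: "m \<le> n" and p: "degree p \<le> m"
    and out: "\<And>j i. j \<in> {..m} - S \<Longrightarrow> i \<le> n \<Longrightarrow> 0 \<le> inner01 (onb j) p * bernstein_coeffs n (onb j) $ i"
  shows "\<exists>J \<mu>. J \<subseteq> {..n} \<and> nonsingular_on n (gram n S) J \<and> (\<forall>i. 0 \<le> \<mu> i) \<and> (\<forall>i. i \<notin> J \<longrightarrow> \<mu> i = 0) \<and>
     (\<forall>i\<in>J. (\<Sum>k\<le>n. gram n S i k * \<mu> k) + bernstein_coeffs n p $ i = 0) \<and>
     (\<forall>i\<le>n. 0 \<le> (\<Sum>k\<le>n. gram n S i k * \<mu> k) + bernstein_coeffs n p $ i)"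
proof (rule complementary_solution_exists)
  let ?u = "\<lambda>i j. bernstein_coeffs n (onb j) $ i"
  have fin: "finite S" using S finite_subset by blast
  show "gram n S i k = gram n S k i" for i k by (simp add: gram_def mult.commute)
  have bilinear: "(\<Sum>i\<le>n. z i * (\<Sum>k\<le>n. gram n S i k * z k)) = (\<Sum>j\<in>S. (\<Sum>i\<le>n. z i * ?u i j)\<^sup>2) / 2" for z
  proof -
    have "(\<Sum>i\<le>n. z i * (\<Sum>k\<le>n. gram n S i k * z k))
        = (\<Sum>i\<le>n. \<Sum>k\<le>n. \<Sum>j\<in>S. (z i * ?u i j) * (z k * ?u k j) / 2)"
      by (simp add: gram_def sum_distrib_left sum_distrib_right sum_divide_distrib mult_ac)
    also have "\<dots> = (\<Sum>i\<le>n. \<Sum>j\<in>S. \<Sum>k\<le>n. (z i * ?u i j) * (z k * ?u k j) / 2)"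
      by (intro sum.cong refl sum.swap)
    also have "\<dots> = (\<Sum>j\<in>S. \<Sum>i\<le>n. \<Sum>k\<le>n. (z i * ?u i j) * (z k * ?u k j) / 2)"
      by (rule sum.swap)
    also have "\<dots> = (\<Sum>j\<in>S. (\<Sum>i\<le>n. z i * ?u i j)\<^sup>2) / 2"
      by (simp add: power2_eq_square sum_product sum_divide_distrib)
    finally show ?thesis .
  qed
  show "0 \<le> (\<Sum>i\<le>n. z i * (\<Sum>k\<le>n. gram n S i k * z k))" for z
    unfolding bilinear by (simp add: sum_nonneg)
  show "0 \<le> (\<Sum>i\<le>n. bernstein_coeffs n p $ i * z i)"
    if z: "\<And>i. 0 \<le> z i" and null: "\<And>i. i \<le> n \<Longrightarrow> (\<Sum>k\<le>n. gram n S i k * z k) = 0" for z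
  proof -
    have "(\<Sum>j\<in>S. (\<Sum>i\<le>n. z i * ?u i j)\<^sup>2) = 0" using bilinear[of z] null by simp
    then have zero: "(\<Sum>i\<le>n. z i * ?u i j) = 0" if "j \<in> S" for j
      using that fin by (subst (asm) sum_nonneg_eq_0_iff) auto
    have "(\<Sum>i\<le>n. bernstein_coeffs n p $ i * z i) = (\<Sum>i\<le>n. \<Sum>j\<le>m. inner01 (onb j) p * (z i * ?u i j))"
      by (intro sum.cong refl) (simp add: bernstein_coeffs_eq_onb_sum[OF p mn] sum_distrib_left sum_distrib_right mult_ac)
    also have "\<dots> = (\<Sum>j\<le>m. inner01 (onb j) p * (\<Sum>i\<le>n. z i * ?u i j))"
      by (subst sum.swap) (simp add: sum_distrib_left)
    also have "\<dots> \<ge> 0"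
    proof (rule sum_nonneg)
      fix j assume j: "j \<in> {..m}"
      show "0 \<le> inner01 (onb j) p * (\<Sum>i\<le>n. z i * ?u i j)"
      proof (cases "j \<in> S")
        case False
        have "0 \<le> (\<Sum>i\<le>n. z i * (inner01 (onb j) p * ?u i j))"
          by (rule sum_nonneg, rule mult_nonneg_nonneg[OF z], rule out) (use False j in auto)
        then show ?thesis by (simp add: sum_distrib_left mult.left_commute)
      qed (simp add: zero)
    qed
    finally show ?thesis .
  qed
  show "\<exists>\<beta>. (\<forall>i. i \<notin> J \<longrightarrow> \<beta> i = 0) \<and> (\<forall>i\<in>J. (\<Sum>k\<le>n. gram n S i k * \<beta> k) = h i)"
    if J: "J \<subseteq> {..n}" and ns: "nonsingular_on n (gram n S) J" for J h
  proof -
    define M where "M = Matrix.mat (n + 1) (n + 1) (\<lambda>(i, k). gram n S i k)"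
    have M: "M $$ (i, k) = gram n S i k" if "i \<le> n" "k \<le> n" for i k using that by (simp add: M_def)
    have "nonsingular_on n (\<lambda>i k. M $$ (i, k)) J"
      using J ns M by (auto simp: nonsingular_on_def subset_eq cong: ball_cong)
    then obtain \<beta> where \<beta>: "\<forall>i. i \<notin> J \<longrightarrow> \<beta> i = 0" "\<forall>i\<in>J. (\<Sum>k\<le>n. M $$ (i, k) * \<beta> k) = h i"
      using nonsingular_on_solvable[of M n J h] J by (auto simp: M_def)
    have "(\<Sum>k\<le>n. gram n S i k * \<beta> k) = h i" if "i \<in> J" for i
    proof -
      have "(\<Sum>k\<le>n. gram n S i k * \<beta> k) = (\<Sum>k\<le>n. M $$ (i, k) * \<beta> k)"
        using that J by (intro sum.cong refl) (auto simp: M)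
      then show ?thesis using \<beta>(2) that by simp
    qed
    then show ?thesis using \<beta>(1) by blast
  qed
qed

text \<open>
  Correctness of the common loop, for any matrix and any formation of y that implement the
  complementarity problem of S.
\<close>

lemma subset_loop_correct:
  assumes S: "S \<subseteq> {..m}" and mn: "m \<le> n" and p: "degree p \<le> m"
    and out: "\<And>j i. j \<in> {..m} - S \<Longrightarrow> i \<le> n \<Longrightarrow> 0 \<le> inner01 (onb j) p * bernstein_coeffs n (onb j) $ i"
    and M: "M \<in> carrier_mat (n + 1) (n + 1)"
    and M_index: "\<And>i k. i \<le> n \<Longrightarrow> k \<le> n \<Longrightarrow> M $$ (i, k) = gram n S i k"
    and form_y: "\<And>\<mu>. dim_vec \<mu> = n + 1 \<Longrightarrow> form_y \<mu>
      = Matrix.vec (n + 1) (\<lambda>i. (\<Sum>k\<le>n. gram n S i k * \<mu> $ k) + bernstein_coeffs n p $ i)"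
    and Js: "set Js = Pow {0..n}"
  obtains q0 where "strict_minimizer m n S p q0"
    "returned (subset_loop m n p (\<lambda>J. submatrix M J J) form_y c Js) = Some (bernstein_coeffs m q0)"
proof -
  let ?g = "\<lambda>i. bernstein_coeffs n p $ i"
  define b where "b J = subvector (- (E_mat m n *\<^sub>v bernstein_coeffs m p)) J" for J
  define sol where "sol J = the (mat_inverse (submatrix M J J)) *\<^sub>v b J" for J
  define ext where "ext J = extend_by_zero n J (sol J)" for J
  define yv where "yv J = form_y (ext J)" for J
  define accept where "accept J \<longleftrightarrow> vec_space.rank (card J) (submatrix M J J) = card J
      \<and> 0\<^sub>v (card J) \<le> sol J \<and> 0\<^sub>v (n + 1) \<le> yv J" for J
  define y where "y J i = (\<Sum>k\<le>n. gram n S i k * ext J $ k) + ?g i" for J i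
  have yv: "yv J = Matrix.vec (n + 1) (y J)" for J
    unfolding yv_def y_def by (rule form_y) (simp add: ext_def)
  have pn: "degree p \<le> n" using p mn by simp
  have b_index: "b J $ k = - ?g (pick J k)" if "J \<subseteq> {..n}" "k < card J" for J k
    using that pick_le_bound[OF that] bernstein_coeffs_spec(1)[OF pn]
    by (simp add: b_def subvector_def E_mat_mult_bernstein_coeffs[OF p mn])
  have b_carrier: "b J \<in> carrier_vec (card J)" for J by (simp add: b_def subvector_def)
  have det: "det (submatrix M J J) \<noteq> 0 \<longleftrightarrow> vec_space.rank (card J) (submatrix M J J) = card J"
    if "J \<subseteq> {..n}" for J
    using vec_space.det_rank_iff[OF submatrix_principal_carrier[OF M that]] .
  have sums: "(submatrix M J J *\<^sub>v x) $ k = (\<Sum>j\<le>n. gram n S (pick J k) j * extend_by_zero n J x $ j)"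
    if J: "J \<subseteq> {..n}" and x: "x \<in> carrier_vec (card J)" and k: "k < card J" for J x k
    unfolding submatrix_mult_vec[OF M J x k]
    using pick_le_bound[OF J k] by (intro sum.cong refl) (simp add: M_index)
  have KKT: "\<exists>q0. strict_minimizer m n S p q0 \<and> degree q0 \<le> m \<and> yv J = bernstein_coeffs n q0"
    if J: "J \<subseteq> {..n}" and acc: "accept J" for J
  proof -
    have fin: "finite J" using J finite_subset by blast
    note A = submatrix_principal_carrier[OF M J]
    have "det (submatrix M J J) \<noteq> 0" using det[OF J] acc by (simp add: accept_def)
    note solves = mat_inverse_solves[OF A this b_carrier, folded sol_def]
    have sol_nonneg: "0 \<le> sol J $ k" if "k < card J" for k
      using acc that zero_vec_le_iff[OF solves(1)] by (simp add: accept_def)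
    have on_J: "0 \<le> ext J $ i \<and> y J i = 0" if "i \<in> J" for i
    proof -
      obtain k where k: "k < card J" "i = pick J k"
        using bij_betw_imp_surj_on[OF pick_bij_betw[OF fin]] \<open>i \<in> J\<close> by auto
      have "ext J $ i = sol J $ k" unfolding ext_def k(2) by (rule extend_by_zero_pick[OF J k(1)])
      moreover have "y J i = 0"
        using sums[OF J solves(1) k(1)] solves(2) b_index[OF J k(1)] by (simp add: y_def ext_def k(2))
      ultimately show ?thesis using sol_nonneg[OF k(1)] by simp
    qed
    have off_J: "ext J $ i = 0" if "i \<le> n" "i \<notin> J" for i using that by (simp add: ext_def)
    have y_nonneg: "0 \<le> y J i" if "i \<le> n" for i
      using acc that zero_vec_le_iff[of "yv J" "n + 1"] by (simp add: accept_def yv)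
    obtain q0 where q0: "strict_minimizer m n S p q0" "degree q0 \<le> m"
      "\<And>i. i \<le> n \<Longrightarrow> bernstein_coeffs n q0 $ i = y J i"
    proof (rule KKT_strict_minimizer[OF S mn p])
      show "0 \<le> ext J $ i" if "i \<le> n" for i using on_J off_J that by (cases "i \<in> J") auto
      show "ext J $ i * y J i = 0" if "i \<le> n" for i using on_J off_J that by (cases "i \<in> J") auto
    qed (use y_nonneg in \<open>auto simp: y_def\<close>)
    have "degree q0 \<le> n" using q0(2) mn by simp
    then have "yv J = bernstein_coeffs n q0"
      using q0(3) bernstein_coeffs_spec(1)[of q0 n] by (intro eq_vecI) (auto simp: yv)
    then show ?thesis using q0 by blast
  qed
  obtain J0 \<mu> where J0: "J0 \<subseteq> {..n}" and ns: "nonsingular_on n (gram n S) J0"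
    and \<mu>: "\<And>i. 0 \<le> \<mu> i" "\<And>i. i \<notin> J0 \<Longrightarrow> \<mu> i = 0"
    and eqs: "\<And>i. i \<in> J0 \<Longrightarrow> (\<Sum>k\<le>n. gram n S i k * \<mu> k) + ?g i = 0"
    and y0: "\<And>i. i \<le> n \<Longrightarrow> 0 \<le> (\<Sum>k\<le>n. gram n S i k * \<mu> k) + ?g i"
    using complementary_solution_gram[OF S mn p out] by blast
  have accept: "accept J0"
  proof -
    note A = submatrix_principal_carrier[OF M J0]
    have "nonsingular_on n (\<lambda>i k. M $$ (i, k)) J0"
      using J0 ns M_index by (auto simp: nonsingular_on_def subset_eq cong: ball_cong)
    then have d: "det (submatrix M J0 J0) \<noteq> 0" using det_principal_submatrix_iff[OF M J0] by blast
    define x where "x = Matrix.vec (card J0) (\<lambda>k. \<mu> (pick J0 k))"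
    have x: "x \<in> carrier_vec (card J0)" by (simp add: x_def)
    have ext_x: "extend_by_zero n J0 x $ i = \<mu> i" if "i \<le> n" for i
      unfolding x_def by (rule extend_by_zero_restrict[OF J0 \<mu>(2) that])
    have "submatrix M J0 J0 *\<^sub>v x = b J0"
    proof (rule eq_vecI)
      fix k assume "k < dim_vec (b J0)"
      then have k: "k < card J0" using b_carrier[of J0] by simp
      have "(submatrix M J0 J0 *\<^sub>v x) $ k = (\<Sum>j\<le>n. gram n S (pick J0 k) j * \<mu> j)"
        unfolding sums[OF J0 x k] by (intro sum.cong refl) (simp add: ext_x del: extend_by_zero_index)
      then show "(submatrix M J0 J0 *\<^sub>v x) $ k = b J0 $ k"
        using eqs[OF pick_in_set_le[OF k]] b_index[OF J0 k] by simp
    qed (use A b_carrier[of J0] in auto)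
    then have sol: "sol J0 = x" using mat_inverse_solution_unique[OF A d x] by (simp add: sol_def)
    have "y J0 i = (\<Sum>k\<le>n. gram n S i k * \<mu> k) + ?g i" if "i \<le> n" for i
      unfolding y_def ext_def sol by (simp add: ext_x del: extend_by_zero_index)
    then have "0\<^sub>v (n + 1) \<le> yv J0" using y0 by (simp add: yv less_eq_vec_def)
    moreover have "0\<^sub>v (card J0) \<le> sol J0" using \<mu>(1) by (simp add: sol x_def less_eq_vec_def)
    ultimately show ?thesis using d det[OF J0] by (simp add: accept_def)
  qed
  obtain q0 where q0: "strict_minimizer m n S p q0" using KKT[OF J0 accept] by blast
  have "returned (subset_loop m n p (\<lambda>J. submatrix M J J) form_y c Js) = Some (bernstein_coeffs m q0)"
  proof (rule subset_loop_returned, fold b_def, fold sol_def, fold ext_def, fold yv_def, fold accept_def)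
    show "\<exists>J\<in>set Js. accept J" using accept J0 Js by (auto simp: atLeast0AtMost)
    fix J assume "J \<in> set Js" "accept J"
    then obtain q where q: "strict_minimizer m n S p q" "degree q \<le> m" "yv J = bernstein_coeffs n q"
      using KKT[of J] Js by (auto simp: atLeast0AtMost)
    have "q = q0" using strict_minimizer_unique[OF q(1) q0] .
    then show "U_mat m m *\<^sub>v (mat_diag (m + 1) (lam n) *\<^sub>v (transpose_mat (U_mat m n) *\<^sub>v yv J))
        = bernstein_coeffs m q0"
      using output_eq_bernstein_coeffs[OF q(2) mn] q(3) by simp
  qed
  then show thesis using that q0 by blast
qed

text \<open>
  Shifting p by the constant d, the integral of \<open>f - p\<close>, lowers the squared distance by \<open>d\<^sup>2\<close>; hence
  p has the same integral as f.
\<close>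

lemma best_L2_approx_integral_nonneg:
  assumes f: "continuous_on {0..1} f" "\<And>x. x \<in> {0..1} \<Longrightarrow> 0 \<le> f x" and best: "best_L2_approx m f p"
  shows "0 \<le> integral01 p"
proof -
  define d where "d = integral {0..1} (\<lambda>x. f x - poly p x)"
  define h where "h x = f x - poly p x" for x
  have h: "continuous_on {0..1} h" unfolding h_def by (intro continuous_intros f(1))
  have int: "h integrable_on {0..1}" "(\<lambda>x. (h x)\<^sup>2) integrable_on {0..1}"
    using h by (auto intro!: integrable_continuous_interval continuous_intros)
  have "degree (p + [:d:]) \<le> m"
    using best by (intro degree_add_le) (auto simp: best_L2_approx_def is_arg_min_def poly_space_def)
  then have "L2_norm (\<lambda>x. f x - poly p x) \<le> L2_norm (\<lambda>x. f x - poly (p + [:d:]) x)"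
    using best by (auto simp: best_L2_approx_def is_arg_min_def poly_space_def not_less)
  then have "integral {0..1} (\<lambda>x. (h x)\<^sup>2) \<le> integral {0..1} (\<lambda>x. (h x - d)\<^sup>2)"
    by (simp add: L2_norm_def h_def algebra_simps)
  also have "\<dots> = integral {0..1} (\<lambda>x. (h x)\<^sup>2 - (2 * d) * h x + d\<^sup>2)"
    by (simp add: power2_eq_square algebra_simps)
  also have "\<dots> = integral {0..1} (\<lambda>x. (h x)\<^sup>2) - (2 * d) * integral {0..1} h + d\<^sup>2"
  proof (rule integral_unique)
    have "((\<lambda>x. d\<^sup>2) has_integral d\<^sup>2) {0..1::real}"
      using has_integral_const_real[of "d\<^sup>2" 0 1] by simp
    then show "((\<lambda>x. (h x)\<^sup>2 - (2 * d) * h x + d\<^sup>2) has_integral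
        integral {0..1} (\<lambda>x. (h x)\<^sup>2) - (2 * d) * integral {0..1} h + d\<^sup>2) {0..1}"
      using int by (intro has_integral_add has_integral_diff has_integral_mult_right integrable_integral)
  qed
  also have "integral {0..1} h = d" by (simp add: d_def h_def[abs_def])
  finally have "d\<^sup>2 \<le> 0" by (simp add: power2_eq_square)
  then have "d = 0" by simp
  then have "integral {0..1} f - integral01 p = 0"
    using integral_diff[OF integrable_continuous_interval[OF f(1)] poly_integrable[of p]]
    by (simp add: d_def integral01_def)
  moreover have "0 \<le> integral {0..1} f"
    using f by (intro integral_nonneg integrable_continuous_interval) auto
  ultimately show ?thesis by simp
qed

lemma W_mat_mult_vec_index:
  assumes "dim_vec \<mu> = n + 1" "i \<le> n" "m \<le> n"
  shows "(W_mat m n *\<^sub>v \<mu>) $ i = (\<Sum>k\<le>n. gram n {..m} i k * \<mu> $ k)"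
proof -
  have "(W_mat m n *\<^sub>v \<mu>) $ i = (\<Sum>k\<in>{0..<n + 1}. W_mat m n $$ (i, k) * \<mu> $ k)"
    using assms W_mat_carrier[of m n] by (auto simp: scalar_prod_def intro!: sum.cong)
  also have "{0..<n + 1} = {..n}" by auto
  finally show ?thesis using assms by (simp add: W_mat_index)
qed

lemma inequality_algorithm_returned:
  assumes mn: "m \<le> n" and p: "degree p \<le> m" and Js: "set Js = Pow {0..n}"
  shows "(\<exists>!q. ineq_minimizer m n p q) \<and>
      (\<forall>q. ineq_minimizer m n p q \<longrightarrow>
         returned (inequality_algorithm m n Js p) = Some (bernstein_coeffs m q))"
proof -
  have pn: "degree p \<le> n" using p mn by simp
  note E = E_mat_mult_bernstein_coeffs[OF p mn]
  have dim_p: "dim_vec (bernstein_coeffs n p) = n + 1" using bernstein_coeffs_spec(1)[OF pn] by simp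
  note W_mult = W_mat_mult_vec_index[OF _ _ mn]
  obtain q0 where q0: "strict_minimizer m n {..m} p q0"
    "returned (inequality_algorithm m n Js p) = Some (bernstein_coeffs m q0)"
    unfolding inequality_algorithm_def
  proof (rule subset_loop_correct[OF subset_refl mn p _ W_mat_carrier _ _ Js])
    show "W_mat m n *\<^sub>v \<mu> + E_mat m n *\<^sub>v bernstein_coeffs m p
        = Matrix.vec (n + 1) (\<lambda>i. (\<Sum>k\<le>n. gram n {..m} i k * \<mu> $ k) + bernstein_coeffs n p $ i)"
      if "dim_vec \<mu> = n + 1" for \<mu>
      unfolding E by (rule eq_vecI) (use that W_mult dim_p in auto)
  qed (use mn in \<open>auto simp: W_mat_index\<close>)
  have "feasible m n {..m} p = (\<lambda>q. q \<in> nonneg_poly_space m n)"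
    by (simp add: feasible_def fun_eq_iff)
  then have "ineq_minimizer m n p q \<longleftrightarrow> q = q0" for q
    using strict_minimizer_is_arg_min_iff[OF q0(1), of q] by (simp add: ineq_minimizer_def)
  then show ?thesis using q0(2) by simp
qed

lemma equality_algorithm_returned:
  assumes mn: "m \<le> n" and p: "degree p \<le> m" and Js: "set Js = Pow {0..n}"
    and approx: "\<exists>f. continuous_on {0..1} f \<and> (\<forall>x\<in>{0..1}. 0 \<le> f x) \<and> best_L2_approx m f p"
  shows "(\<exists>!q. eq_minimizer m n p q) \<and>
      (\<forall>q. eq_minimizer m n p q \<longrightarrow>
         returned (equality_algorithm m n Js p) = Some (bernstein_coeffs m q))"
proof -
  have pn: "degree p \<le> n" using p mn by simp
  note E = E_mat_mult_bernstein_coeffs[OF p mn]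
  have dim_p: "dim_vec (bernstein_coeffs n p) = n + 1" using bernstein_coeffs_spec(1)[OF pn] by simp
  note W_mult = W_mat_mult_vec_index[OF _ _ mn]
  have W_dim: "dim_row (W_mat m n) = n + 1" using W_mat_carrier[of m n] by (rule carrier_matD(1))
  have "0 \<le> integral01 p" using approx best_L2_approx_integral_nonneg by blast
  then have p0: "0 \<le> inner01 (onb 0) p" by (simp add: inner01_def onb_0)
  have diff: "{..m} - {1..m} = {0}" by auto
  obtain q0 where q0: "strict_minimizer m n {1..m} p q0"
    "returned (equality_algorithm m n Js p) = Some (bernstein_coeffs m q0)"
    unfolding equality_algorithm_def
  proof (rule subset_loop_correct[OF _ mn p _ _ _ _ Js])
    show "{1..m} \<subseteq> {..m}" by auto
    show "0 \<le> inner01 (onb j) p * bernstein_coeffs n (onb j) $ i" if "j \<in> {..m} - {1..m}" "i \<le> n" for j i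
      using that p0 unfolding diff by (simp add: onb_0 bernstein_coeffs_1)
    show "Matrix.mat (n + 1) (n + 1) (\<lambda>(i, j). W_mat m n $$ (i, j) - 1 / 2) \<in> carrier_mat (n + 1) (n + 1)"
      by simp
    show "Matrix.mat (n + 1) (n + 1) (\<lambda>(i, j). W_mat m n $$ (i, j) - 1 / 2) $$ (i, k) = gram n {1..m} i k"
      if "i \<le> n" "k \<le> n" for i k
      using that mn gram_without_constant[OF that, of m] by (simp add: W_mat_index)
    show "(let \<nu> = \<Sum>i\<le>n. \<mu> $ i in W_mat m n *\<^sub>v \<mu> - (\<nu> / 2) \<cdot>\<^sub>v ones n + E_mat m n *\<^sub>v bernstein_coeffs m p)
        = Matrix.vec (n + 1) (\<lambda>i. (\<Sum>k\<le>n. gram n {1..m} i k * \<mu> $ k) + bernstein_coeffs n p $ i)"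
      if \<mu>: "dim_vec \<mu> = n + 1" for \<mu>
    proof -
      have "(\<Sum>k\<le>n. gram n {1..m} i k * \<mu> $ k) = (W_mat m n *\<^sub>v \<mu>) $ i - (\<Sum>k\<le>n. \<mu> $ k) / 2"
        if "i \<le> n" for i
      proof -
        have "(\<Sum>k\<le>n. gram n {1..m} i k * \<mu> $ k) = (\<Sum>k\<le>n. gram n {..m} i k * \<mu> $ k - \<mu> $ k / 2)"
          by (intro sum.cong refl) (use that gram_without_constant in \<open>auto simp: left_diff_distrib\<close>)
        then show ?thesis using W_mult[OF \<mu> that] by (simp add: sum_subtractf sum_divide_distrib)
      qed
      then show ?thesis
        unfolding E Let_def by (intro eq_vecI) (use dim_p W_dim in \<open>auto simp: ones_def\<close>)
    qed
  qed
  have "feasible m n {1..m} p = (\<lambda>q. q \<in> nonneg_poly_space m n \<and> integral {0..1} (poly p) = integral {0..1} (poly q))"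
    unfolding feasible_def diff by (auto simp: fun_eq_iff onb_0 inner01_def integral01_def)
  then have "eq_minimizer m n p q \<longleftrightarrow> q = q0" for q
    using strict_minimizer_is_arg_min_iff[OF q0(1), of q] by (simp add: eq_minimizer_def)
  then show ?thesis using q0(2) by simp
qed

lemma inequality_algorithm_operations_le:
  assumes "distinct Js" "set Js = Pow {0..n}"
  shows "operations (inequality_algorithm m n Js p)
      \<le> real (nonneg_solutions (inequality_algorithm m n Js p)) * ((real n + 1) * (2 * real n + 2 * real m + 3))
         + (real n + 1) * (2 * real m + 1) + 2 * (real m + 1)\<^sup>2
         + 2 powi (int n - 1) / 3 * (real n + 1)\<^sup>2 * (real n + 4)"
  unfolding inequality_algorithm_def
  using subset_loop_operations_le[of m n p _ _ "y_cost_ineq m n" Js]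
  unfolding total_solve_cost[OF assms] q_cost_def y_cost_ineq_def by (simp only: add.assoc)

lemma equality_algorithm_operations_le:
  assumes "distinct Js" "set Js = Pow {0..n}"
  shows "operations (equality_algorithm m n Js p)
      \<le> real (nonneg_solutions (equality_algorithm m n Js p)) * (2 * (real n + 1) * (real n + real m + 2) + real n)
         + (real n + 1) * (2 * real m + 1) + 2 * (real m + 1)\<^sup>2
         + 2 powi (int n - 1) / 3 * (real n + 1)\<^sup>2 * (real n + 4)"
  unfolding equality_algorithm_def
  using subset_loop_operations_le[of m n p _ _ "y_cost_eq m n" Js]
  unfolding total_solve_cost[OF assms] q_cost_def y_cost_eq_def by (simp only: add.assoc)

text \<open>
  Whether a principal submatrix is nonsingular depends only on the entries with indices up to n.
\<close>

lemma nonsingular_on_cong: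
  "J \<subseteq> {..n} \<Longrightarrow> (\<And>i k. i \<le> n \<Longrightarrow> k \<le> n \<Longrightarrow> W i k = W' i k) \<Longrightarrow>
   nonsingular_on n W J \<Longrightarrow> nonsingular_on n W' J"
  by (auto simp: nonsingular_on_def subset_iff cong: sum.cong) (auto cong: ball_cong)

theorem theorem4:
  fixes m n :: nat and p :: "real poly" and Js :: "nat set list"
  assumes "m \<le> n"
    and "distinct Js" and "set Js = Pow {0..n}"
    and "p \<in> poly_space m"
  shows
    "((\<exists>!q. ineq_minimizer m n p q) \<and>
      (\<forall>q. ineq_minimizer m n p q \<longrightarrow>
         returned (inequality_algorithm m n Js p) = Some (bernstein_coeffs m q)) \<and>
      operations (inequality_algorithm m n Js p)
        \<le> real (nonneg_solutions (inequality_algorithm m n Js p))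
              * ((real n + 1) * (2 * real n + 2 * real m + 3))
           + (real n + 1) * (2 * real m + 1) + 2 * (real m + 1)\<^sup>2
           + 2 powi (int n - 1) / 3 * (real n + 1)\<^sup>2 * (real n + 4)) \<and>
     ((\<exists>f. continuous_on {0..1} f \<and> (\<forall>x\<in>{0..1}. 0 \<le> f x) \<and> best_L2_approx m f p) \<longrightarrow>
      (\<exists>!q. eq_minimizer m n p q) \<and>
      (\<forall>q. eq_minimizer m n p q \<longrightarrow>
         returned (equality_algorithm m n Js p) = Some (bernstein_coeffs m q)) \<and>
      operations (equality_algorithm m n Js p)
        \<le> real (nonneg_solutions (equality_algorithm m n Js p))
              * (2 * (real n + 1) * (real n + real m + 2) + real n)
           + (real n + 1) * (2 * real m + 1) + 2 * (real m + 1)\<^sup>2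
           + 2 powi (int n - 1) / 3 * (real n + 1)\<^sup>2 * (real n + 4))"
  by (intro conjI impI
      inequality_algorithm_returned[OF assms(1) assms(4)[unfolded poly_space_def mem_Collect_eq] assms(3), THEN conjunct1]
      inequality_algorithm_returned[OF assms(1) assms(4)[unfolded poly_space_def mem_Collect_eq] assms(3), THEN conjunct2]
      equality_algorithm_returned[OF assms(1) assms(4)[unfolded poly_space_def mem_Collect_eq] assms(3), THEN conjunct1]
      equality_algorithm_returned[OF assms(1) assms(4)[unfolded poly_space_def mem_Collect_eq] assms(3), THEN conjunct2]
      inequality_algorithm_operations_le[OF assms(2,3)] equality_algorithm_operations_le[OF assms(2,3)];
      assumption)

end
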